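(* Let $G=(\mathcal V,\mathcal E)$ be a finite simple connected graph with at least one edge, and let $(\vec u_t,\vec v_t)_{t\ge 0}$ be the random opinion process on $G$ described in the context, started from deterministic initial weights $u_0^i,v_0^i\ge 0$ with $u_0^i+v_0^i>0$ for all $i\in\mathcal V$. Let $\vec x_t=(x_t^i)_{i\in\mathcal V}$ with $x_t^i=u_t^i/g_t^i$. Then there exists a random scalar $a_\infty$ with $0\le a_\infty\le 1$ such that $$\mathbb E\big[\|\vec x_t-a_\infty\vec 1\|^2\big]\xrightarrow[t\to\infty]{}0 .$$
   Context: Each vertex $i$ carries at time $t\in\{0,1,2,\dots\}$ weights $u_t^i,v_t^i\ge 0$; put $g_t^i:=u_t^i+v_t^i$ and $x_t^i:=u_t^i/g_t^i$. For an edge $e=(i,j)$ put $p_t^e:=\frac{u_t^i+u_t^j}{g_t^i+g_t^j}$. Dynamics: at every time $t\ge 1$ an edge $e=(i,j)\in\mathcal E$ is chosen uniformly at random, independently of the past. Then $g_t^i=g_{t-1}^i+1$ and $g_t^j=g_{t-1}^j+1$, and $g_t^k=g_{t-1}^k$ for $k\notin\{i,j\}$. Given the past and the chosen edge $e$, with conditional probability $p_{t-1}^e$ the two agents agree on state $U$, in which case $u_t^i=u_{t-1}^i+1$ and $u_t^j=u_{t-1}^j+1$; otherwise (agreement on state $V$) $u_t^i=u_{t-1}^i$ and $u_t^j=u_{t-1}^j$. In both cases $u_t^k=u_{t-1}^k$ for $k\notin\{i,j\}$. $\vec 1\in\mathbb R^{\mathcal V}$ is the all-ones vector and $\|\cdot\|$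 is the Euclidean norm. *)

theory Defs
  imports "HOL-Probability.Probability"
begin

definition simple_graph :: "'v set \<Rightarrow> 'v set set \<Rightarrow> bool" where
  "simple_graph V E \<longleftrightarrow> finite V \<and> (\<forall>\<epsilon>\<in>E. \<epsilon> \<subseteq> V \<and> card \<epsilon> = 2)"

definition connected_graph :: "'v set \<Rightarrow> 'v set set \<Rightarrow> bool" where
  "connected_graph V E \<longleftrightarrow> V \<noteq> {} \<and> (\<forall>i\<in>V. \<forall>j\<in>V. (i, j) \<in> {(k, l). {k, l} \<in> E}\<^sup>*)"

definition vertex_share :: "('v \<Rightarrow> real) \<Rightarrow> ('v \<Rightarrow> real) \<Rightarrow> 'v \<Rightarrow> real" where
  "vertex_share u v i = u i / (u i + v i)"

definition edge_share :: "('v \<Rightarrow> real) \<Rightarrow> ('v \<Rightarrow> real) \<Rightarrow> 'v set \<Rightarrow> real" where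
  "edge_share u v \<epsilon> = (\<Sum>i\<in>\<epsilon>. u i) / (\<Sum>i\<in>\<epsilon>. (u i + v i))"

definition history :: "(nat \<Rightarrow> 'w \<Rightarrow> 'e) \<Rightarrow> (nat \<Rightarrow> 'w \<Rightarrow> bool) \<Rightarrow> nat \<Rightarrow> 'w \<Rightarrow> ('e \<times> bool) list" where
  "history e agU t \<omega> = map (\<lambda>s. (e s \<omega>, agU s \<omega>)) [1..<Suc t]"

text \<open>
  The process lives on an arbitrary probability space. For \<open>t \<ge> 1\<close>, \<open>e t\<close> is the edge chosen
  at time \<open>t\<close> and \<open>agU t\<close> says whether its endpoints then agree on state U; the values at
  index 0 play no role. As the initial weights are deterministic, \<open>history e agU t\<close> generates
  the whole past up to time \<open>t\<close>, including the weights. It takes finitely many values, so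
  conditioning on the past and the chosen edge is elementary conditioning on the events of
  positive probability.
\<close>

locale opinion_process = prob_space M
  for M :: "'w measure" and V :: "'v set" and E :: "'v set set"
    and u0 v0 :: "'v \<Rightarrow> real"
    and e :: "nat \<Rightarrow> 'w \<Rightarrow> 'v set" and agU :: "nat \<Rightarrow> 'w \<Rightarrow> bool"
    and u v :: "nat \<Rightarrow> 'w \<Rightarrow> 'v \<Rightarrow> real" +
  assumes init:
      "\<And>\<omega> i. \<lbrakk>\<omega> \<in> space M; i \<in> V\<rbrakk> \<Longrightarrow> u 0 \<omega> i = u0 i \<and> v 0 \<omega> i = v0 i"
    and edge_measurable: "\<And>t. e (Suc t) \<in> measurable M (count_space E)"
    and agreement_measurable: "\<And>t. agU (Suc t) \<in> measurable M (count_space UNIV)"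
    and edge_uniform: "\<And>t. distr M (count_space E) (e (Suc t)) = uniform_count_measure E"
    and edge_indep_past:
      "\<And>t. indep_set (sets (vimage_algebra (space M) (e (Suc t)) (count_space E)))
              (sets (vimage_algebra (space M) (history e agU t) (count_space UNIV)))"
    and agreement_prob:
      "\<And>t \<omega>\<^sub>0. \<lbrakk>\<omega>\<^sub>0 \<in> space M;
          \<P>(\<omega> in M. history e agU t \<omega> = history e agU t \<omega>\<^sub>0 \<and> e (Suc t) \<omega> = e (Suc t) \<omega>\<^sub>0) > 0\<rbrakk>
        \<Longrightarrow> \<P>(\<omega> in M. agU (Suc t) \<omega> \<bar>
               history e agU t \<omega> = history e agU t \<omega>\<^sub>0 \<and> e (Suc t) \<omega> = e (Suc t) \<omega>\<^sub>0)
            = edge_share (u t \<omega>\<^sub>0) (v t \<omega>\<^sub>0) (e (Suc t) \<omega>\<^sub>0)"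
    and total_step:
      "\<And>t \<omega> i. \<lbrakk>\<omega> \<in> space M; i \<in> V\<rbrakk> \<Longrightarrow>
        u (Suc t) \<omega> i + v (Suc t) \<omega> i =
          (if i \<in> e (Suc t) \<omega> then u t \<omega> i + v t \<omega> i + 1 else u t \<omega> i + v t \<omega> i)"
    and U_step:
      "\<And>t \<omega> i. \<lbrakk>\<omega> \<in> space M; i \<in> V\<rbrakk> \<Longrightarrow>
        u (Suc t) \<omega> i =
          (if i \<in> e (Suc t) \<omega> \<and> agU (Suc t) \<omega> then u t \<omega> i + 1 else u t \<omega> i)"

end

theory Submission
  imports Defs
begin

text \<open>
  Let \<open>m\<close> be the number of edges, \<open>D k\<close> the probability that the chosen edge contains \<open>k\<close>, and
  \<open>T = t + 1\<close>. The increment of the share \<open>x k\<close> has conditional mean \<open>p - x k\<close> divided by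
  \<open>g k + 1\<close>. Weighting by \<open>(D k)\<^sup>2\<close> makes this rate \<open>(D k)\<^sup>2 / (g k + 1)\<close> approximately
  \<open>g k / T\<^sup>2\<close>, and the drift \<open>g k * (p - x k)\<close> sums to zero over each edge. Hence
  \<open>L = (\<Sum>k. (D k)\<^sup>2 * x k)\<close> is almost a martingale, and \<open>S = (\<Sum>k. (D k)\<^sup>2 * (x k)\<^sup>2)\<close> is almost a
  supermartingale that loses a multiple of \<open>1 / T\<close> times the dissipation
  \<open>\<Sum>\<epsilon>. \<Sum>k\<in>\<epsilon>. (x k - p \<epsilon>)\<^sup>2\<close>. The errors are of order \<open>T powr (- 3 / 2)\<close> in mean, hence summable.

  So \<open>L\<close> is Cauchy in \<open>L\<^sup>2\<close>; and \<open>S\<close> minus the square of \<open>L\<close> over the total weight, which is the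
  weighted variance of the shares, converges in mean. By connectedness the variance is bounded by a
  multiple of the dissipation, whose expectation is summable against \<open>1 / T\<close>; as the harmonic
  series diverges, the limit of the mean variance is zero.
\<close>

subsection \<open>Real sequences\<close>

text \<open>A deterministic Robbins-Siegmund argument: \<open>s t\<close> plus the losses so far
  minus the gains so far decreases and stays above \<open>- suminf b\<close>. It will be applied to
  expectations, with the noise as gain.\<close>

lemma almost_decreasing_convergent:
  fixes s b c :: "nat \<Rightarrow> real"
  assumes step: "\<And>t. s (Suc t) \<le> s t - c t + b t"
    and s: "\<And>t. s t \<ge> 0" and c: "\<And>t. c t \<ge> 0" and b: "\<And>t. b t \<ge> 0" "summable b"
  shows "convergent s" and "summable c"
proof -
  have b_le: "(\<Sum>i<t. b i) \<le> suminf b" for t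
    using b by (intro sum_le_suminf) auto
  have bound: "s t + (\<Sum>i<t. c i) \<le> s 0 + (\<Sum>i<t. b i)" for t
  proof (induction t)
    case (Suc t)
    then show ?case using step[of t] by simp
  qed simp
  show sc: "summable c"
  proof (rule summableI_nonneg_bounded[OF c])
    show "(\<Sum>i<t. c i) \<le> s 0 + suminf b" for t using bound[of t] b_le[of t] s[of t] by linarith
  qed
  define P where "P t = s t + (\<Sum>i<t. c i) - (\<Sum>i<t. b i)" for t
  have "decseq P"
    unfolding decseq_Suc_iff P_def using step by (auto simp: algebra_simps)
  moreover have "\<forall>t. - suminf b \<le> P t"
  proof
    show "- suminf b \<le> P t" for t
      unfolding P_def using s[of t] sum_nonneg[of "{..<t}" c] c b_le[of t] by force
  qed
  ultimately obtain l where l: "P \<longlonglongrightarrow> l" using decseq_convergent by blast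
  have "(\<lambda>t. P t - (\<Sum>i<t. c i) + (\<Sum>i<t. b i)) \<longlonglongrightarrow> l - suminf c + suminf b"
    by (intro tendsto_intros l summable_LIMSEQ sc b)
  then show "convergent s" unfolding P_def by (auto simp: convergent_def)
qed

text \<open>With a positive limit \<open>l\<close>, eventually \<open>f t > l / 2\<close>, and the
  summable series would dominate a multiple of the harmonic one.\<close>

lemma harmonic_weighted_limit_zero:
  fixes f :: "nat \<Rightarrow> real"
  assumes "convergent f" "\<And>t. f t \<ge> 0" "summable (\<lambda>t. f t / Suc t)"
  shows "f \<longlonglongrightarrow> 0"
proof -
  obtain l where l: "f \<longlonglongrightarrow> l" using assms(1) by (auto simp: convergent_def)
  have "l \<ge> 0" using l assms(2) by (intro LIMSEQ_le_const) auto
  moreover have "\<not> l > 0"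
  proof
    assume "l > 0"
    then have ev: "eventually (\<lambda>t. f t > l / 2) sequentially"
      using l by (intro order_tendstoD(1)) auto
    have "summable (\<lambda>t. l / 2 / Suc t)"
    proof (rule summable_comparison_test_ev[OF _ assms(3)])
      show "eventually (\<lambda>t. norm (l / 2 / Suc t) \<le> f t / Suc t) sequentially"
        using ev
      proof eventually_elim
        case (elim t)
        have "norm (l / 2 / Suc t) = l / 2 / Suc t" using \<open>l > 0\<close> by simp
        also have "\<dots> \<le> f t / Suc t" using elim by (intro divide_right_mono) auto
        finally show ?case .
      qed
    qed
    then have "summable (\<lambda>t. 2 / l * (l / 2 / Suc t))" by (rule summable_mult)
    moreover have "2 / l * (l / 2 / Suc t) = inverse (real (Suc t))" for t
      using \<open>l > 0\<close> by (simp add: field_simps)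
    ultimately have "summable (\<lambda>t. inverse (real (Suc t)))" by simp
    then show False using not_summable_harmonic[where 'a = real] by (subst (asm) summable_Suc_iff) simp
  qed
  ultimately show ?thesis using l by (cases "l = 0") auto
qed

lemma summable_inverse_sqrt_cube: "summable (\<lambda>t. C / sqrt (Suc t) ^ 3)"
proof -
  have "sqrt (Suc t) ^ 3 = real (Suc t) powr (3 / 2)" for t
  proof -
    have "sqrt (Suc t) ^ 3 = sqrt (Suc t) powr 3" by (subst powr_numeral) auto
    also have "\<dots> = (real (Suc t) powr (1 / 2)) powr 3" by (simp add: powr_half_sqrt)
    finally show ?thesis by (simp only: powr_powr) simp
  qed
  then have "C / sqrt (Suc t) ^ 3 = C * real (Suc t) powr (- 3 / 2)" for t
    by (simp add: powr_minus_divide)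
  moreover have "summable (\<lambda>t. real (Suc t) powr (- 3 / 2))"
    by (subst summable_Suc_iff) (simp add: summable_real_powr_iff)
  ultimately show ?thesis by (simp only: summable_mult)
qed

subsection \<open>Averaging over one step\<close>

text \<open>\<open>f (Y \<omega>)\<close> is a finite combination of indicators of level sets, so
  only these have to be events and no sigma-algebra is chosen on the range. This suits histories,
  whose values are lists.\<close>

lemma (in prob_space) integral_finite_range:
  fixes f :: "'b \<Rightarrow> real"
  assumes "finite R" and Y: "\<And>\<omega>. \<omega> \<in> space M \<Longrightarrow> Y \<omega> \<in> R"
    and ev: "\<And>y. y \<in> R \<Longrightarrow> {\<omega> \<in> space M. Y \<omega> = y} \<in> events"
  shows "integrable M (\<lambda>\<omega>. f (Y \<omega>))"
    and "(\<integral>\<omega>. f (Y \<omega>) \<partial>M) = (\<Sum>y\<in>R. f y * prob {\<omega> \<in> space M. Y \<omega> = y})"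
proof -
  let ?A = "\<lambda>y. {\<omega> \<in> space M. Y \<omega> = y}"
  have eq: "f (Y \<omega>) = (\<Sum>y\<in>R. f y * indicator (?A y) \<omega>)" if "\<omega> \<in> space M" for \<omega>
  proof -
    have "(\<Sum>y\<in>R. f y * indicator (?A y) \<omega>) = (\<Sum>y\<in>R. if y = Y \<omega> then f y else 0)"
      using that by (intro sum.cong) (auto simp: indicator_def)
    then show ?thesis using Y[OF that] \<open>finite R\<close> by simp
  qed
  have int: "integrable M (\<lambda>\<omega>. f y * indicator (?A y) \<omega>)" if "y \<in> R" for y
    using ev[OF that] by (intro integrable_mult_right) (auto simp: emeasure_eq_measure)
  show "integrable M (\<lambda>\<omega>. f (Y \<omega>))"
    using int by (subst Bochner_Integration.integrable_cong[OF refl eq]) auto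
  have "(\<integral>\<omega>. f (Y \<omega>) \<partial>M) = (\<integral>\<omega>. (\<Sum>y\<in>R. f y * indicator (?A y) \<omega>) \<partial>M)"
    by (rule Bochner_Integration.integral_cong[OF refl eq])
  also have "\<dots> = (\<Sum>y\<in>R. \<integral>\<omega>. f y * indicator (?A y) \<omega> \<partial>M)"
    by (rule Bochner_Integration.integral_sum[OF int])
  also have "\<dots> = (\<Sum>y\<in>R. f y * prob (?A y))"
    by (intro sum.cong refl) (simp add: Int_absorb1 inf_commute[of _ "space M"] Collect_conj_eq)
  finally show "(\<integral>\<omega>. f (Y \<omega>) \<partial>M) = (\<Sum>y\<in>R. f y * prob (?A y))" .
qed

locale opinion_graph = opinion_process +
  assumes simple: "simple_graph V E" and connected: "connected_graph V E"
    and edges_nonempty: "E \<noteq> {}"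
    and u0_nonneg: "\<And>i. i \<in> V \<Longrightarrow> u0 i \<ge> 0" and v0_nonneg: "\<And>i. i \<in> V \<Longrightarrow> v0 i \<ge> 0"
    and weight0_pos: "\<And>i. i \<in> V \<Longrightarrow> u0 i + v0 i > 0"
begin

section \<open>The past as a sigma-algebra with finitely many atoms\<close>

definition past :: "nat \<Rightarrow> 'a measure" where
  "past t = vimage_algebra (space M) (history e agU t) (count_space UNIV)"

definition histories :: "nat \<Rightarrow> ('b set \<times> bool) list set" where
  "histories t = {h. set h \<subseteq> E \<times> UNIV \<and> length h = t}"

lemma finite_V: "finite V" and edge_subset: "\<epsilon> \<in> E \<Longrightarrow> \<epsilon> \<subseteq> V" and card_edge: "\<epsilon> \<in> E \<Longrightarrow> card \<epsilon> = 2"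
  using simple by (auto simp: simple_graph_def)

lemma finite_edge: "\<epsilon> \<in> E \<Longrightarrow> finite \<epsilon>"
  using edge_subset finite_V finite_subset by blast

lemma finite_E: "finite E"
  using edge_subset finite_V by (meson Pow_iff finite_Pow_iff finite_subset subsetI)

lemma card_E_pos: "card E > 0"
  using finite_E edges_nonempty by (simp add: card_gt_0_iff)

lemma finite_histories: "finite (histories t)"
  unfolding histories_def using finite_lists_length_eq[of "E \<times> (UNIV :: bool set)" t] finite_E by simp

lemma edge_in_E: "\<omega> \<in> space M \<Longrightarrow> e (Suc t) \<omega> \<in> E"
  using measurable_space[OF edge_measurable] by simp

lemma history_Suc: "history e agU (Suc t) \<omega> = history e agU t \<omega> @ [(e (Suc t) \<omega>, agU (Suc t) \<omega>)]"
  by (simp add: history_def)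

lemma history_in_histories: "\<omega> \<in> space M \<Longrightarrow> history e agU t \<omega> \<in> histories t"
proof (induction t)
  case 0
  then show ?case by (simp add: history_def histories_def)
next
  case (Suc t)
  then show ?case using edge_in_E[of \<omega> t] by (auto simp: history_Suc histories_def)
qed

lemma space_past [simp]: "space (past t) = space M"
  by (simp add: past_def)

lemma sets_past: "sets (past t) = {history e agU t -` B \<inter> space M | B. True}"
  by (simp add: past_def sets_vimage_algebra2)

lemma subalgebra_past: "subalgebra M (past t)"
  unfolding subalgebra_def
  using indep_setD_ev2[OF edge_indep_past[of t]] by (simp add: past_def)

lemma measurable_past_imp: "X \<in> borel_measurable (past t) \<Longrightarrow> X \<in> borel_measurable M"
  using measurable_from_subalg[OF subalgebra_past] .

lemma history_event: "{\<omega> \<in> space M. history e agU t \<omega> = h} \<in> sets (past t)"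
  unfolding sets_past by (rule CollectI, rule exI[of _ "{h}"]) auto

lemma edge_event: "{\<omega> \<in> space M. e (Suc t) \<omega> = \<epsilon>} \<in> events"
proof (cases "\<epsilon> \<in> E")
  case True
  have "e (Suc t) -` {\<epsilon>} \<inter> space M \<in> events"
    using True by (intro measurable_sets[OF edge_measurable]) auto
  then show ?thesis by (simp add: vimage_def Int_def conj_commute)
next
  case False
  then have empty: "{\<omega> \<in> space M. e (Suc t) \<omega> = \<epsilon>} = {}" using edge_in_E by auto
  show ?thesis unfolding empty by simp
qed

lemma agreement_event: "{\<omega> \<in> space M. agU (Suc t) \<omega> = b} \<in> events"
proof -
  have "agU (Suc t) -` {b} \<inter> space M \<in> events"
    by (intro measurable_sets[OF agreement_measurable]) auto
  then show ?thesis by (simp add: vimage_def Int_def conj_commute)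
qed

text \<open>Every set of lists counts as measurable, so past-measurable functions are exactly those
  constant on the fibres of the history map. Measurability of the weights thus reduces to comparing
  outcomes with equal histories.\<close>

lemma past_measurable_iff:
  fixes X :: "'a \<Rightarrow> real"
  shows "X \<in> borel_measurable (past t) \<longleftrightarrow>
    (\<forall>\<omega>\<in>space M. \<forall>\<omega>'\<in>space M. history e agU t \<omega> = history e agU t \<omega>' \<longrightarrow> X \<omega> = X \<omega>')"
proof safe
  fix \<omega> \<omega>'
  assume X: "X \<in> borel_measurable (past t)" and \<omega>: "\<omega> \<in> space M" "\<omega>' \<in> space M"
    and eq: "history e agU t \<omega> = history e agU t \<omega>'"
  have "X -` {X \<omega>} \<inter> space (past t) \<in> sets (past t)"
    using X by (rule measurable_sets) simp
  then obtain B where B: "X -` {X \<omega>} \<inter> space M = history e agU t -` B \<inter> space M"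
    by (auto simp: sets_past)
  then have "\<omega> \<in> history e agU t -` B \<inter> space M" using \<omega> by blast
  then have "\<omega>' \<in> X -` {X \<omega>} \<inter> space M" using \<omega> eq unfolding B by auto
  then show "X \<omega> = X \<omega>'" by auto
next
  assume X: "\<forall>\<omega>\<in>space M. \<forall>\<omega>'\<in>space M. history e agU t \<omega> = history e agU t \<omega>' \<longrightarrow> X \<omega> = X \<omega>'"
  \<comment> \<open>A Doob-Dynkin factor, evaluated at a chosen outcome with history
    \<open>h\<close>; lists that never occur receive an arbitrary value.\<close>
  define f where "f h = X (SOME \<omega>. \<omega> \<in> space M \<and> history e agU t \<omega> = h)" for h
  have f: "X \<omega> = f (history e agU t \<omega>)" if "\<omega> \<in> space M" for \<omega>
    using someI[of "\<lambda>\<omega>'. \<omega>' \<in> space M \<and> history e agU t \<omega>' = history e agU t \<omega>" \<omega>] that X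
    unfolding f_def by metis
  have "history e agU t \<in> measurable (past t) (count_space UNIV)"
    unfolding past_def by (rule measurable_vimage_algebra1) simp
  then have "(\<lambda>\<omega>. f (history e agU t \<omega>)) \<in> borel_measurable (past t)"
    by (rule measurable_compose) simp
  then show "X \<in> borel_measurable (past t)"
    by (subst measurable_cong[of _ _ "\<lambda>\<omega>. f (history e agU t \<omega>)"]) (use f in auto)
qed

lemma past_factor:
  fixes X :: "'a \<Rightarrow> real"
  assumes "X \<in> borel_measurable (past t)"
  obtains f where "\<And>\<omega>. \<omega> \<in> space M \<Longrightarrow> X \<omega> = f (history e agU t \<omega>)"
proof
  show "X \<omega> = X (SOME \<omega>'. \<omega>' \<in> space M \<and> history e agU t \<omega>' = history e agU t \<omega>)" if "\<omega> \<in> space M" for \<omega>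
    using someI[of "\<lambda>\<omega>'. \<omega>' \<in> space M \<and> history e agU t \<omega>' = history e agU t \<omega>" \<omega>] that
      assms unfolding past_measurable_iff by metis
qed

text \<open>There are finitely many histories of length \<open>t\<close>, so \<open>X\<close> takes
  finitely many values.\<close>

lemma past_integrable:
  fixes X :: "'a \<Rightarrow> real"
  assumes "X \<in> borel_measurable (past t)"
  shows "integrable M X"
proof -
  obtain f where f: "\<And>\<omega>. \<omega> \<in> space M \<Longrightarrow> X \<omega> = f (history e agU t \<omega>)"
    using past_factor[OF assms] by blast
  have "integrable M (\<lambda>\<omega>. f (history e agU t \<omega>))"
    using finite_histories history_in_histories history_event subalgebra_past[of t]
    by (intro integral_finite_range(1)[of "histories t"]) (auto simp: subalgebra_def)
  then show ?thesis using f by (subst Bochner_Integration.integrable_cong[OF refl f]) auto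
qed

abbreviation g :: "nat \<Rightarrow> 'a \<Rightarrow> 'b \<Rightarrow> real" where
  "g t \<omega> i \<equiv> u t \<omega> i + v t \<omega> i"
abbreviation x :: "nat \<Rightarrow> 'a \<Rightarrow> 'b \<Rightarrow> real" where
  "x t \<omega> i \<equiv> vertex_share (u t \<omega>) (v t \<omega>) i"
abbreviation p :: "nat \<Rightarrow> 'a \<Rightarrow> 'b set \<Rightarrow> real" where
  "p t \<omega> \<epsilon> \<equiv> edge_share (u t \<omega>) (v t \<omega>) \<epsilon>"

text \<open>Induction along the recursion: \<open>U_step\<close> determines \<open>u\<close>, and
  \<open>v\<close> is then recovered from the total.\<close>

lemma weights_determined:
  assumes "\<omega> \<in> space M" "\<omega>' \<in> space M" "i \<in> V" "history e agU t \<omega> = history e agU t \<omega>'"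
  shows "u t \<omega> i = u t \<omega>' i \<and> v t \<omega> i = v t \<omega>' i"
  using assms(4)
proof (induction t)
  case 0
  then show ?case using init assms by auto
next
  case (Suc t)
  then have IH: "u t \<omega> i = u t \<omega>' i" "v t \<omega> i = v t \<omega>' i"
    and eq: "e (Suc t) \<omega> = e (Suc t) \<omega>'" "agU (Suc t) \<omega> = agU (Suc t) \<omega>'"
    by (simp_all add: history_Suc)
  show ?case
    using U_step[of \<omega> i t] U_step[of \<omega>' i t] total_step[of \<omega> i t] total_step[of \<omega>' i t] assms IH eq
    by (simp split: if_splits)
qed

lemma past_u [measurable]: "i \<in> V \<Longrightarrow> (\<lambda>\<omega>. u t \<omega> i) \<in> borel_measurable (past t)"
  and past_v [measurable]: "i \<in> V \<Longrightarrow> (\<lambda>\<omega>. v t \<omega> i) \<in> borel_measurable (past t)"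
  unfolding past_measurable_iff using weights_determined by blast+

lemma past_x [measurable]: "i \<in> V \<Longrightarrow> (\<lambda>\<omega>. x t \<omega> i) \<in> borel_measurable (past t)"
  unfolding vertex_share_def by measurable

lemma past_p [measurable]:
  assumes "\<epsilon> \<in> E" shows "(\<lambda>\<omega>. p t \<omega> \<epsilon>) \<in> borel_measurable (past t)"
proof -
  have [measurable]: "(\<lambda>\<omega>. u t \<omega> i) \<in> borel_measurable (past t)"
    "(\<lambda>\<omega>. v t \<omega> i) \<in> borel_measurable (past t)" if "i \<in> \<epsilon>" for i
    using that edge_subset[OF assms] by auto
  show ?thesis unfolding edge_share_def by measurable
qed

section \<open>Transition probabilities and the tower property\<close>

lemma history_edge_prob:
  assumes "\<epsilon> \<in> E"
  shows "prob {\<omega> \<in> space M. history e agU t \<omega> = h \<and> e (Suc t) \<omega> = \<epsilon>}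
    = prob {\<omega> \<in> space M. history e agU t \<omega> = h} / card E"
proof -
  have "prob {\<omega> \<in> space M. e (Suc t) \<omega> = \<epsilon>} = measure (distr M (count_space E) (e (Suc t))) {\<epsilon>}"
    using assms edge_measurable
    by (subst measure_distr) (auto intro!: arg_cong[of _ _ prob])
  also have "\<dots> = 1 / card E"
    unfolding edge_uniform using assms finite_E by (subst measure_uniform_count_measure) auto
  finally have "prob {\<omega> \<in> space M. e (Suc t) \<omega> = \<epsilon>} = 1 / card E" .
  moreover have "prob ({\<omega> \<in> space M. e (Suc t) \<omega> = \<epsilon>} \<inter> {\<omega> \<in> space M. history e agU t \<omega> = h})
    = prob {\<omega> \<in> space M. e (Suc t) \<omega> = \<epsilon>} * prob {\<omega> \<in> space M. history e agU t \<omega> = h}"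
  proof (rule indep_setD[OF edge_indep_past])
    have "e (Suc t) -` {\<epsilon>} \<inter> space M \<in> sets (vimage_algebra (space M) (e (Suc t)) (count_space E))"
      using assms by (intro in_vimage_algebra) auto
    then show "{\<omega> \<in> space M. e (Suc t) \<omega> = \<epsilon>} \<in> sets (vimage_algebra (space M) (e (Suc t)) (count_space E))"
      by (simp add: vimage_def Int_def conj_commute)
    show "{\<omega> \<in> space M. history e agU t \<omega> = h}
      \<in> sets (vimage_algebra (space M) (history e agU t) (count_space UNIV))"
      using history_event[of t h] by (simp add: past_def)
  qed
  moreover have "{\<omega> \<in> space M. history e agU t \<omega> = h \<and> e (Suc t) \<omega> = \<epsilon>}
    = {\<omega> \<in> space M. e (Suc t) \<omega> = \<epsilon>} \<inter> {\<omega> \<in> space M. history e agU t \<omega> = h}"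
    by auto
  ultimately show ?thesis by simp
qed

lemma transition_prob:
  assumes "\<epsilon> \<in> E" and "\<omega>\<^sub>0 \<in> space M"
  shows "prob {\<omega> \<in> space M. history e agU t \<omega> = history e agU t \<omega>\<^sub>0 \<and> e (Suc t) \<omega> = \<epsilon> \<and> agU (Suc t) \<omega> = b}
    = prob {\<omega> \<in> space M. history e agU t \<omega> = history e agU t \<omega>\<^sub>0} / card E
      * (if b then p t \<omega>\<^sub>0 \<epsilon> else 1 - p t \<omega>\<^sub>0 \<epsilon>)"
proof -
  let ?h = "history e agU t \<omega>\<^sub>0"
  let ?A = "{\<omega> \<in> space M. history e agU t \<omega> = ?h \<and> e (Suc t) \<omega> = \<epsilon>}"
  let ?B = "\<lambda>b. {\<omega> \<in> space M. history e agU t \<omega> = ?h \<and> e (Suc t) \<omega> = \<epsilon> \<and> agU (Suc t) \<omega> = b}"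
  have A: "?A \<in> events"
  proof -
    have "?A = {\<omega> \<in> space M. history e agU t \<omega> = ?h} \<inter> {\<omega> \<in> space M. e (Suc t) \<omega> = \<epsilon>}" by auto
    then show ?thesis using history_event[of t ?h] edge_event[of t \<epsilon>] subalgebra_past[of t]
      by (auto simp: subalgebra_def)
  qed
  have B: "?B b \<in> events" for b
  proof -
    have "?B b = ?A \<inter> {\<omega> \<in> space M. agU (Suc t) \<omega> = b}" by auto
    then show ?thesis using A agreement_event[of t b] by auto
  qed
  have sum: "prob ?A = prob (?B True) + prob (?B False)"
  proof -
    have "?A = ?B True \<union> ?B False" by auto
    moreover have "?B True \<inter> ?B False = {}" by auto
    ultimately show ?thesis using finite_measure_Union[OF B B, of True False] by simp
  qed
  \<comment> \<open>\<open>agreement_prob\<close> speaks of the edge chosen at a given outcome, and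
    only for positive probability. If \<open>?A\<close> is null, both sides vanish. Otherwise it
    contains an outcome \<open>\<omega>\<^sub>1\<close> at which \<epsilon> is chosen, and the edge
    share is the same there as at \<open>\<omega>\<^sub>0\<close> because it depends on the history
    alone.\<close>
  have true: "prob (?B True) = prob ?A * p t \<omega>\<^sub>0 \<epsilon>"
  proof (cases "prob ?A = 0")
    case True
    moreover have "prob (?B True) \<le> prob ?A" using A by (intro finite_measure_mono) auto
    ultimately show ?thesis using measure_nonneg[of M "?B True"] by (simp add: measure_le_0_iff)
  next
    case False
    then have "?A \<noteq> {}" by (metis measure_empty)
    then obtain \<omega>\<^sub>1 where \<omega>\<^sub>1: "\<omega>\<^sub>1 \<in> space M" "history e agU t \<omega>\<^sub>1 = ?h" "e (Suc t) \<omega>\<^sub>1 = \<epsilon>" by blast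
    have "p t \<omega>\<^sub>1 \<epsilon> = p t \<omega>\<^sub>0 \<epsilon>"
      using past_p[OF assms(1), of t] \<omega>\<^sub>1 assms(2) unfolding past_measurable_iff by blast
    moreover have "prob ?A > 0" using False measure_nonneg[of M ?A] by linarith
    ultimately have "\<P>(\<omega> in M. agU (Suc t) \<omega> \<bar> history e agU t \<omega> = ?h \<and> e (Suc t) \<omega> = \<epsilon>) = p t \<omega>\<^sub>0 \<epsilon>"
      using agreement_prob[OF \<omega>\<^sub>1(1), of t] \<omega>\<^sub>1 by simp
    then show ?thesis using False by (simp add: cond_prob_def field_simps conj_ac)
  qed
  show ?thesis
    using true sum history_edge_prob[OF assms(1), of t ?h] by (cases b) (simp_all add: algebra_simps)
qed

text \<open>The conditional expectation of \<open>F (e (Suc t)) (agU (Suc t))\<close> given the past up to time \<open>t\<close>.\<close>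

definition step_mean :: "nat \<Rightarrow> ('b set \<Rightarrow> bool \<Rightarrow> 'a \<Rightarrow> real) \<Rightarrow> 'a \<Rightarrow> real" where
  "step_mean t F \<omega> =
    (\<Sum>\<epsilon>\<in>E. p t \<omega> \<epsilon> * F \<epsilon> True \<omega> + (1 - p t \<omega> \<epsilon>) * F \<epsilon> False \<omega>) / card E"

lemma past_step_mean:
  assumes "\<And>\<epsilon> b. \<epsilon> \<in> E \<Longrightarrow> F \<epsilon> b \<in> borel_measurable (past t)"
  shows "step_mean t F \<in> borel_measurable (past t)"
  unfolding step_mean_def using assms by measurable

text \<open>The tower property, obtained by a finite summation over histories, edges and outcomes.
  For each fixed edge and outcome the integrand depends on the past only.\<close>

lemma integral_step:
  assumes F: "\<And>\<epsilon> b. \<epsilon> \<in> E \<Longrightarrow> F \<epsilon> b \<in> borel_measurable (past t)"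
  shows "(\<integral>\<omega>. F (e (Suc t) \<omega>) (agU (Suc t) \<omega>) \<omega> \<partial>M) = (\<integral>\<omega>. step_mean t F \<omega> \<partial>M)"
proof -
  let ?H = "history e agU t"
  let ?pr = "\<lambda>h. prob {\<omega> \<in> space M. ?H \<omega> = h}"
  have "\<forall>\<epsilon>\<in>E. \<forall>b. \<exists>f. \<forall>\<omega>\<in>space M. F \<epsilon> b \<omega> = f (?H \<omega>)"
    using past_factor[OF F] by metis
  then obtain f where f: "\<And>\<epsilon> b \<omega>. \<epsilon> \<in> E \<Longrightarrow> \<omega> \<in> space M \<Longrightarrow> F \<epsilon> b \<omega> = f \<epsilon> b (?H \<omega>)"
    by metis
  have "\<forall>\<epsilon>\<in>E. \<exists>q. \<forall>\<omega>\<in>space M. p t \<omega> \<epsilon> = q (?H \<omega>)"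
    using past_factor[OF past_p] by metis
  then obtain q where q: "\<And>\<epsilon> \<omega>. \<epsilon> \<in> E \<Longrightarrow> \<omega> \<in> space M \<Longrightarrow> p t \<omega> \<epsilon> = q \<epsilon> (?H \<omega>)"
    by metis
  let ?Y = "\<lambda>\<omega>. (?H \<omega>, e (Suc t) \<omega>, agU (Suc t) \<omega>)"
  let ?G = "\<lambda>(h, \<epsilon>, b). f \<epsilon> b h"
  let ?mean = "\<lambda>h. (\<Sum>\<epsilon>\<in>E. q \<epsilon> h * f \<epsilon> True h + (1 - q \<epsilon> h) * f \<epsilon> False h) / card E"
  \<comment> \<open>\<open>transition_prob\<close> covers the histories of actual outcomes; for
    every other list \<open>h\<close> both sides are 0.\<close>
  have joint: "prob {\<omega> \<in> space M. ?Y \<omega> = (h, \<epsilon>, b)} = ?pr h / card E * (if b then q \<epsilon> h else 1 - q \<epsilon> h)"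
    if "\<epsilon> \<in> E" for h \<epsilon> b
  proof (cases "\<exists>\<omega>\<^sub>0\<in>space M. ?H \<omega>\<^sub>0 = h")
    case True
    then show ?thesis using transition_prob[OF that, of _ t b] q[OF that] by auto
  next
    case False
    then have empty: "{\<omega> \<in> space M. ?Y \<omega> = (h, \<epsilon>, b)} = {}" "{\<omega> \<in> space M. ?H \<omega> = h} = {}" by auto
    show ?thesis unfolding empty by simp
  qed
  have past_ev: "{\<omega> \<in> space M. ?H \<omega> = h} \<in> events" for h
    using history_event subalgebra_past by (auto simp: subalgebra_def)
  have ev: "{\<omega> \<in> space M. ?Y \<omega> = y} \<in> events" for y
  proof -
    have "{\<omega> \<in> space M. ?Y \<omega> = y} = {\<omega> \<in> space M. ?H \<omega> = fst y} \<inter>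
      {\<omega> \<in> space M. e (Suc t) \<omega> = fst (snd y)} \<inter> {\<omega> \<in> space M. agU (Suc t) \<omega> = snd (snd y)}"
      by (auto simp: prod_eq_iff)
    then show ?thesis using past_ev edge_event agreement_event by auto
  qed
  have "(\<integral>\<omega>. F (e (Suc t) \<omega>) (agU (Suc t) \<omega>) \<omega> \<partial>M) = (\<integral>\<omega>. ?G (?Y \<omega>) \<partial>M)"
    using f edge_in_E by (intro Bochner_Integration.integral_cong) auto
  also have "\<dots> = (\<Sum>y\<in>histories t \<times> E \<times> UNIV. ?G y * prob {\<omega> \<in> space M. ?Y \<omega> = y})"
    using finite_histories finite_E history_in_histories edge_in_E ev
    by (intro integral_finite_range(2)) auto
  also have "\<dots> = (\<Sum>h\<in>histories t. \<Sum>\<epsilon>\<in>E. \<Sum>b\<in>UNIV.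
      f \<epsilon> b h * prob {\<omega> \<in> space M. ?Y \<omega> = (h, \<epsilon>, b)})"
    by (simp add: sum.cartesian_product case_prod_beta prod_eq_iff)
  also have "\<dots> = (\<Sum>h\<in>histories t. \<Sum>\<epsilon>\<in>E. \<Sum>b\<in>UNIV.
      f \<epsilon> b h * (?pr h / card E * (if b then q \<epsilon> h else 1 - q \<epsilon> h)))"
    by (intro sum.cong refl) (simp only: joint)
  also have "\<dots> = (\<Sum>h\<in>histories t. ?mean h * ?pr h)"
    unfolding sum_divide_distrib sum_distrib_right
    by (intro sum.cong refl) (simp add: UNIV_bool field_simps add_divide_distrib diff_divide_distrib)
  also have "\<dots> = (\<integral>\<omega>. ?mean (?H \<omega>) \<partial>M)"
    by (rule integral_finite_range(2)[symmetric])
      (use finite_histories history_in_histories past_ev in blast)+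
  also have "\<dots> = (\<integral>\<omega>. step_mean t F \<omega> \<partial>M)"
    using f q by (intro Bochner_Integration.integral_cong) (auto simp: step_mean_def)
  finally show ?thesis .
qed

subsection \<open>Weights and meeting frequencies\<close>

lemma weights_nonneg:
  assumes "\<omega> \<in> space M" "i \<in> V"
  shows "u t \<omega> i \<ge> 0" and "v t \<omega> i \<ge> 0" and "g t \<omega> i > 0"
proof -
  have "u t \<omega> i \<ge> 0 \<and> v t \<omega> i \<ge> 0 \<and> g t \<omega> i > 0"
  proof (induction t)
    case 0
    then show ?case using init[OF assms] u0_nonneg v0_nonneg weight0_pos assms by simp
  next
    case (Suc t)
    then show ?case using U_step[OF assms, of t] total_step[OF assms, of t] by (auto split: if_splits)
  qed
  then show "u t \<omega> i \<ge> 0" "v t \<omega> i \<ge> 0" "g t \<omega> i > 0" by auto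
qed

lemma share_bounds:
  assumes "\<omega> \<in> space M" "i \<in> V"
  shows "0 \<le> x t \<omega> i" and "x t \<omega> i \<le> 1"
  using weights_nonneg[OF assms, of t] by (auto simp: vertex_share_def)

lemma edge_total_pos:
  assumes "\<omega> \<in> space M" "\<epsilon> \<in> E"
  shows "(\<Sum>i\<in>\<epsilon>. g t \<omega> i) > 0"
proof (rule sum_pos)
  show "\<epsilon> \<noteq> {}" using card_edge[OF assms(2)] by auto
  show "finite \<epsilon>" by (rule finite_edge[OF assms(2)])
  show "g t \<omega> i > 0" if "i \<in> \<epsilon>" for i using weights_nonneg(3) assms edge_subset that by blast
qed

lemma edge_share_bounds:
  assumes "\<omega> \<in> space M" "\<epsilon> \<in> E"
  shows "0 \<le> p t \<omega> \<epsilon>" and "p t \<omega> \<epsilon> \<le> 1"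
proof -
  have nn: "u t \<omega> i \<ge> 0" "v t \<omega> i \<ge> 0" if "i \<in> \<epsilon>" for i
    using weights_nonneg assms edge_subset that by blast+
  show "0 \<le> p t \<omega> \<epsilon>" unfolding edge_share_def using nn by (intro divide_nonneg_nonneg sum_nonneg) auto
  have "(\<Sum>i\<in>\<epsilon>. u t \<omega> i) \<le> (\<Sum>i\<in>\<epsilon>. g t \<omega> i)" using nn by (intro sum_mono) auto
  then show "p t \<omega> \<epsilon> \<le> 1" unfolding edge_share_def using edge_total_pos[OF assms, of t] by simp
qed

text \<open>As \<open>g * x = u\<close>, the edge share is the mean of the endpoint shares weighted
  by \<open>g\<close>. This cancellation makes the drifts small once the rates are replaced by
  multiples of \<open>g\<close>.\<close>

lemma edge_balance:
  assumes "\<omega> \<in> space M" "\<epsilon> \<in> E"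
  shows "(\<Sum>k\<in>\<epsilon>. g t \<omega> k * (p t \<omega> \<epsilon> - x t \<omega> k)) = 0"
proof -
  have "g t \<omega> k * x t \<omega> k = u t \<omega> k" if "k \<in> \<epsilon>" for k
    using weights_nonneg(3)[OF assms(1), of k t] edge_subset[OF assms(2)] that by (auto simp: vertex_share_def)
  then have "(\<Sum>k\<in>\<epsilon>. g t \<omega> k * (p t \<omega> \<epsilon> - x t \<omega> k))
    = (\<Sum>k\<in>\<epsilon>. g t \<omega> k) * p t \<omega> \<epsilon> - (\<Sum>k\<in>\<epsilon>. u t \<omega> k)"
    unfolding sum_distrib_right sum_subtractf[symmetric] by (intro sum.cong) (auto simp: algebra_simps)
  then show ?thesis using edge_total_pos[OF assms, of t] by (simp add: edge_share_def)
qed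

definition D :: "'b \<Rightarrow> real" where
  "D k = card {\<epsilon> \<in> E. k \<in> \<epsilon>} / card E"

lemma D_eq: "D k = (\<Sum>\<epsilon>\<in>E. of_bool (k \<in> \<epsilon>)) / card E"
  using finite_E by (simp add: D_def Int_def)

lemma D_le_1: "D k \<le> 1"
  using card_mono[OF finite_E, of "{\<epsilon> \<in> E. k \<in> \<epsilon>}"] card_E_pos by (simp add: D_def)

text \<open>An edge has two endpoints, so some vertex differs from \<open>k\<close>; a path from
  \<open>k\<close> to it starts with an edge at \<open>k\<close>, and one edge already contributes
  \<open>1 / card E\<close>.\<close>

lemma D_ge:
  assumes "k \<in> V" shows "D k \<ge> 1 / card E"
proof -
  obtain \<epsilon> where \<epsilon>: "\<epsilon> \<in> E" using edges_nonempty by blast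
  have "\<not> \<epsilon> \<subseteq> {k}" using card_edge[OF \<epsilon>] card_mono[of "{k}" \<epsilon>] by auto
  then obtain l where l: "l \<in> V" "l \<noteq> k" using edge_subset[OF \<epsilon>] by auto
  have "(k, l) \<in> {(k, l). {k, l} \<in> E}\<^sup>*" using connected assms l by (auto simp: connected_graph_def)
  then obtain j where "{k, j} \<in> E" using l(2) by (auto elim: converse_rtranclE)
  then have "card {\<epsilon> \<in> E. k \<in> \<epsilon>} > 0" using finite_E by (auto simp: card_gt_0_iff)
  then show ?thesis by (auto simp: D_def intro!: divide_right_mono)
qed

lemma D_pos: "k \<in> V \<Longrightarrow> D k > 0"
  using D_ge[of k] card_E_pos by (meson less_le_trans of_nat_0_less_iff zero_less_divide_1_iff)

text \<open>Double counting of the incident pairs of edges and vertices.\<close>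

lemma sum_edges_vertices:
  fixes f :: "'b \<Rightarrow> real"
  shows "(\<Sum>\<epsilon>\<in>E. \<Sum>k\<in>\<epsilon>. f k) / card E = (\<Sum>k\<in>V. D k * f k)"
proof -
  have "(\<Sum>\<epsilon>\<in>E. \<Sum>k\<in>\<epsilon>. f k) = (\<Sum>\<epsilon>\<in>E. \<Sum>k\<in>V. of_bool (k \<in> \<epsilon>) * f k)"
  proof (rule sum.cong[OF refl])
    fix \<epsilon> assume "\<epsilon> \<in> E"
    then have "V \<inter> \<epsilon> = \<epsilon>" using edge_subset by blast
    then show "(\<Sum>k\<in>\<epsilon>. f k) = (\<Sum>k\<in>V. of_bool (k \<in> \<epsilon>) * f k)"
      using finite_V sum.inter_restrict[of V f \<epsilon>] by (simp add: of_bool_def if_distrib[of "\<lambda>c. c * _"] cong: if_cong)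
  qed
  also have "\<dots> = (\<Sum>k\<in>V. (\<Sum>\<epsilon>\<in>E. of_bool (k \<in> \<epsilon>)) * f k)"
    unfolding sum_distrib_right by (rule sum.swap)
  finally show ?thesis
    unfolding D_eq by (simp add: sum_divide_distrib[where A = V])
qed

lemma sum_edges_vertices_le:
  fixes f :: "'b \<Rightarrow> real"
  assumes "\<And>k. k \<in> V \<Longrightarrow> f k \<ge> 0"
  shows "(\<Sum>\<epsilon>\<in>E. \<Sum>k\<in>\<epsilon>. f k) / card E \<le> (\<Sum>k\<in>V. f k)"
  unfolding sum_edges_vertices
proof (rule sum_mono)
  fix k assume "k \<in> V"
  then show "D k * f k \<le> f k" using mult_right_mono[OF D_le_1, of "f k" k] assms by simp
qed

lemma share_step:
  assumes "\<omega> \<in> space M" "i \<in> V"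
  shows "x (Suc t) \<omega> i = (if i \<in> e (Suc t) \<omega>
    then x t \<omega> i + (of_bool (agU (Suc t) \<omega>) - x t \<omega> i) / (g t \<omega> i + 1) else x t \<omega> i)"
proof (cases "i \<in> e (Suc t) \<omega>")
  case True
  have g: "g t \<omega> i > 0" using weights_nonneg(3)[OF assms] .
  have "(u t \<omega> i + c) / (g t \<omega> i + 1) = x t \<omega> i + (c - x t \<omega> i) / (g t \<omega> i + 1)" for c
  proof -
    have "u t \<omega> i = x t \<omega> i * g t \<omega> i" using g by (simp add: vertex_share_def)
    then show ?thesis using g by (simp add: field_simps)
  qed
  moreover have "x (Suc t) \<omega> i = (u t \<omega> i + of_bool (agU (Suc t) \<omega>)) / (g t \<omega> i + 1)"
    unfolding vertex_share_def using True U_step[OF assms, of t] total_step[OF assms, of t] by simp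
  ultimately show ?thesis using True by simp
next
  case False
  then show ?thesis
    unfolding vertex_share_def using U_step[OF assms, of t] total_step[OF assms, of t] by simp
qed

section \<open>Moment bounds for the total weights\<close>

lemma convex_self: "a * y + (1 - a) * y = (y :: real)"
  by (simp add: algebra_simps)

text \<open>The centring is at \<open>D k * (t + 1)\<close> rather than \<open>D k * t\<close>, so that no rate degenerates at time 0.\<close>

definition Z :: "nat \<Rightarrow> 'a \<Rightarrow> 'b \<Rightarrow> real" where
  "Z t \<omega> k = g t \<omega> k - D k * real (Suc t)"

lemma past_Z [measurable]: "k \<in> V \<Longrightarrow> (\<lambda>\<omega>. Z t \<omega> k) \<in> borel_measurable (past t)"
  unfolding Z_def by measurable

text \<open>\<open>Z\<close> is a martingale with increments
  \<open>of_bool (k \<in> \<epsilon>) - D k\<close>, whose conditional variance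
  \<open>D k * (1 - D k)\<close> is at most 1.\<close>

lemma expectation_Z_square:
  assumes k: "k \<in> V"
  shows "(\<integral>\<omega>. (Z t \<omega> k)\<^sup>2 \<partial>M) \<le> (u0 k + v0 k - D k)\<^sup>2 + t"
proof (induction t)
  case 0
  have "(\<integral>\<omega>. (Z 0 \<omega> k)\<^sup>2 \<partial>M) = (\<integral>\<omega>. (u0 k + v0 k - D k)\<^sup>2 \<partial>M)"
    by (intro Bochner_Integration.integral_cong) (use init k in \<open>auto simp: Z_def\<close>)
  then show ?case by (simp add: prob_space)
next
  case (Suc t)
  define F where "F \<epsilon> (b :: bool) \<omega> = (Z t \<omega> k + (of_bool (k \<in> \<epsilon>) - D k))\<^sup>2" for \<epsilon> b \<omega>
  have mean: "step_mean t F \<omega> \<le> (Z t \<omega> k)\<^sup>2 + 1" for \<omega>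
  proof -
    \<comment> \<open>An indicator equals its square, so \<open>F\<close> is affine in it and
      averaging over the edges turns the indicator into \<open>D k\<close>. The outcome
      \<open>b\<close> does not enter, so the edge shares cancel by
      \<open>convex_self\<close>.\<close>
    have *: "F \<epsilon> b \<omega> = (Z t \<omega> k - D k)\<^sup>2 + (1 + 2 * (Z t \<omega> k - D k)) * of_bool (k \<in> \<epsilon>)" for \<epsilon> b
      unfolding F_def by (simp add: power2_eq_square algebra_simps)
    have "step_mean t F \<omega> = (\<Sum>\<epsilon>\<in>E. (Z t \<omega> k - D k)\<^sup>2 + (1 + 2 * (Z t \<omega> k - D k)) * of_bool (k \<in> \<epsilon>)) / card E"
      unfolding step_mean_def * convex_self ..
    also have "\<dots> = (Z t \<omega> k - D k)\<^sup>2 + (1 + 2 * (Z t \<omega> k - D k)) * D k"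
      using card_E_pos unfolding D_eq
      by (simp only: sum.distrib sum_distrib_left[symmetric] add_divide_distrib) simp
    also have "\<dots> = (Z t \<omega> k)\<^sup>2 + D k * (1 - D k)"
      by (simp add: power2_eq_square algebra_simps)
    also have "D k * (1 - D k) \<le> 1"
      using mult_mono[of "D k" 1 "1 - D k" 1] D_le_1[of k] D_pos[OF k] by simp
    finally show ?thesis by simp
  qed
  have F: "F \<epsilon> b \<in> borel_measurable (past t)" for \<epsilon> b
    unfolding F_def using k by measurable
  have "(\<integral>\<omega>. (Z (Suc t) \<omega> k)\<^sup>2 \<partial>M) = (\<integral>\<omega>. F (e (Suc t) \<omega>) (agU (Suc t) \<omega>) \<omega> \<partial>M)"
    by (intro Bochner_Integration.integral_cong)
      (use total_step k in \<open>auto simp: Z_def F_def algebra_simps\<close>)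
  also have "\<dots> = (\<integral>\<omega>. step_mean t F \<omega> \<partial>M)"
    by (rule integral_step[OF F])
  also have "\<dots> \<le> (\<integral>\<omega>. (Z t \<omega> k)\<^sup>2 + 1 \<partial>M)"
    by (intro integral_mono past_integrable[of _ t] past_step_mean F mean) (use k in measurable)
  also have "\<dots> = (\<integral>\<omega>. (Z t \<omega> k)\<^sup>2 \<partial>M) + 1"
    using k by (subst Bochner_Integration.integral_add) (auto simp: prob_space intro!: past_integrable[of _ t])
  finally show ?case using Suc by simp
qed

text \<open>A Chernoff bound: \<open>k\<close> is met with conditional probability
  \<open>D k\<close>, and a meeting multiplies \<open>exp (- g)\<close> by \<open>exp (-1)\<close>,
  which is at most 1/2. The mean therefore shrinks at least by the factor
  \<open>1 - D k / 2\<close>.\<close>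

lemma expectation_exp_weight:
  assumes k: "k \<in> V"
  shows "(\<integral>\<omega>. exp (- g t \<omega> k) \<partial>M) \<le> exp (- (D k * t / 2))"
proof (induction t)
  case 0
  have "(\<integral>\<omega>. exp (- g 0 \<omega> k) \<partial>M) = (\<integral>\<omega>. exp (- (u0 k + v0 k)) \<partial>M)"
    by (intro Bochner_Integration.integral_cong) (use init k in auto)
  then show ?case using weight0_pos[OF k] by (simp add: prob_space)
next
  case (Suc t)
  define F where "F \<epsilon> (b :: bool) \<omega> = exp (- g t \<omega> k - of_bool (k \<in> \<epsilon>))" for \<epsilon> b \<omega>
  have mean: "step_mean t F \<omega> \<le> exp (- (D k / 2)) * exp (- g t \<omega> k)" for \<omega>
  proof -
    have *: "F \<epsilon> b \<omega> = exp (- g t \<omega> k) * (1 - (1 - exp (-1)) * of_bool (k \<in> \<epsilon>))" for \<epsilon> b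
      unfolding F_def by (simp add: exp_diff exp_minus divide_inverse)
    have "step_mean t F \<omega> = (\<Sum>\<epsilon>\<in>E. exp (- g t \<omega> k) * (1 - (1 - exp (-1)) * of_bool (k \<in> \<epsilon>))) / card E"
      unfolding step_mean_def * convex_self ..
    also have "\<dots> = exp (- g t \<omega> k) * (1 - (1 - exp (-1)) * D k)"
      using card_E_pos unfolding D_eq
      by (simp only: sum_subtractf sum_distrib_left[symmetric] diff_divide_distrib) (simp add: field_simps)
    also have "1 - (1 - exp (-1)) * D k \<le> 1 - D k / 2"
    proof -
      have "exp (-1 :: real) \<le> 1 / 2"
        using exp_ge_add_one_self[of "1 :: real"] by (simp add: exp_minus field_simps)
      then show ?thesis using mult_right_mono[of "1/2" "1 - exp (-1)" "D k"] D_pos[OF k] by simp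
    qed
    also have "1 - D k / 2 \<le> exp (- (D k / 2))"
      using exp_ge_add_one_self[of "- (D k / 2)"] by simp
    finally show ?thesis by (simp add: mult.commute)
  qed
  have F: "F \<epsilon> b \<in> borel_measurable (past t)" for \<epsilon> b
    unfolding F_def using k by measurable
  have "(\<integral>\<omega>. exp (- g (Suc t) \<omega> k) \<partial>M) = (\<integral>\<omega>. F (e (Suc t) \<omega>) (agU (Suc t) \<omega>) \<omega> \<partial>M)"
    by (intro Bochner_Integration.integral_cong) (use total_step k in \<open>auto simp: F_def algebra_simps\<close>)
  also have "\<dots> = (\<integral>\<omega>. step_mean t F \<omega> \<partial>M)"
    by (rule integral_step[OF F])
  also have "\<dots> \<le> (\<integral>\<omega>. exp (- (D k / 2)) * exp (- g t \<omega> k) \<partial>M)"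
    by (intro integral_mono past_integrable[of _ t] past_step_mean F mean) (use k in measurable)
  also have "\<dots> \<le> exp (- (D k / 2)) * exp (- (D k * t / 2))"
    using Suc by simp
  also have "\<dots> = exp (- (D k * Suc t / 2))"
    unfolding exp_add[symmetric] by (simp add: field_simps)
  finally show ?case .
qed

text \<open>The step size with which the share of \<open>k\<close> moves if \<open>k\<close> takes
  part in the next meeting.\<close>

definition r :: "nat \<Rightarrow> 'a \<Rightarrow> 'b \<Rightarrow> real" where
  "r t \<omega> k = 1 / (g t \<omega> k + 1)"

lemma past_r [measurable]: "k \<in> V \<Longrightarrow> (\<lambda>\<omega>. r t \<omega> k) \<in> borel_measurable (past t)"
  unfolding r_def by measurable

lemma r_bounds: "\<omega> \<in> space M \<Longrightarrow> k \<in> V \<Longrightarrow> 0 < r t \<omega> k \<and> r t \<omega> k \<le> 1"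
  using weights_nonneg(3)[of \<omega> k t] by (auto simp: r_def)

lemma expectation_r_square:
  assumes k: "k \<in> V"
  shows "(\<integral>\<omega>. (r t \<omega> k)\<^sup>2 \<partial>M) \<le> (16 + 32 * exp 1) / (D k * Suc t)\<^sup>2"
proof -
  \<comment> \<open>A large deviation bound is needed: by the second moment alone \<open>g\<close> is small with probability
    only \<open>O(1 / t)\<close>, which is not summable.\<close>
  define K where "K = D k * Suc t / 4"
  have K: "K > 0" using D_pos[OF k] by (simp add: K_def)
  \<comment> \<open>Either \<open>g\<close> is at least \<open>K\<close>, and the first term
    suffices, or the exponential term exceeds 1, which bounds the square of
    \<open>r\<close>.\<close>
  have "(r t \<omega> k)\<^sup>2 \<le> 1 / K\<^sup>2 + exp K * exp (- g t \<omega> k)" if \<omega>: "\<omega> \<in> space M" for \<omega>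
  proof (cases "K \<le> g t \<omega> k")
    case True
    then have "r t \<omega> k \<le> 1 / K" unfolding r_def using K by (intro divide_left_mono) auto
    then have "(r t \<omega> k)\<^sup>2 \<le> (1 / K)\<^sup>2" using r_bounds[OF \<omega> k, of t] by (intro power_mono) auto
    moreover have "exp K * exp (- g t \<omega> k) > 0" by simp
    ultimately show ?thesis unfolding power_one_over by linarith
  next
    case False
    then have "1 \<le> exp K * exp (- g t \<omega> k)" unfolding exp_add[symmetric] by simp
    moreover have "(r t \<omega> k)\<^sup>2 \<le> 1" using r_bounds[OF \<omega> k, of t] by (simp add: power_le_one)
    moreover have "1 / K\<^sup>2 \<ge> 0" by simp
    ultimately show ?thesis by linarith
  qed
  then have "(\<integral>\<omega>. (r t \<omega> k)\<^sup>2 \<partial>M) \<le> (\<integral>\<omega>. 1 / K\<^sup>2 + exp K * exp (- g t \<omega> k) \<partial>M)"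
    using k by (intro integral_mono past_integrable[of _ t]) measurable
  also have "\<dots> = 1 / K\<^sup>2 + exp K * (\<integral>\<omega>. exp (- g t \<omega> k) \<partial>M)"
    using k by (subst Bochner_Integration.integral_add) (auto simp: prob_space intro!: past_integrable[of _ t])
  also have "\<dots> \<le> 1 / K\<^sup>2 + exp K * exp (- (D k * t / 2))"
    using expectation_exp_weight[OF k] by simp
  \<comment> \<open>The quarter in \<open>K\<close> pays off here:
    \<open>2 * K - D k * t / 2\<close> equals \<open>D k / 2\<close>, at most 1, so a decay
    \<open>exp (- K)\<close> survives.\<close>
  also have "exp K * exp (- (D k * t / 2)) \<le> exp 1 * exp (- K)"
    unfolding exp_add[symmetric] using D_le_1[of k] by (simp add: K_def field_simps)
  also have "exp (- K) \<le> 2 / K\<^sup>2"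
    using exp_lower_Taylor_quadratic[of K] K by (simp add: exp_minus field_simps)
  also have "1 / K\<^sup>2 + exp 1 * (2 / K\<^sup>2) = (16 + 32 * exp 1) / (D k * Suc t)\<^sup>2"
    using K unfolding K_def by (simp add: power_divide field_simps)
  finally show ?thesis by simp
qed

subsection \<open>Drift of the weighted sums\<close>

text \<open>Bounds, up to constants, every error term of the drift estimates at a vertex.\<close>

definition noise :: "nat \<Rightarrow> 'a \<Rightarrow> 'b \<Rightarrow> real" where
  "noise t \<omega> k = \<bar>Z t \<omega> k\<bar> / (real (Suc t))\<^sup>2 + \<bar>Z t \<omega> k\<bar> * r t \<omega> k / real (Suc t)
    + (r t \<omega> k)\<^sup>2 + 1 / (real (Suc t))\<^sup>2"

lemma past_noise [measurable]: "k \<in> V \<Longrightarrow> (\<lambda>\<omega>. noise t \<omega> k) \<in> borel_measurable (past t)"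
  unfolding noise_def by measurable

lemma noise_nonneg: "\<omega> \<in> space M \<Longrightarrow> k \<in> V \<Longrightarrow> noise t \<omega> k \<ge> 0"
  using r_bounds[of \<omega> k t] by (auto simp: noise_def)

text \<open>Because \<open>D k * T = g - Z\<close>, multiplication of the difference by
  \<open>T\<^sup>2\<close> gives exactly \<open>- (Z * r * (D k * T) + Z * (r * g) + r * g)\<close>,
  in which \<open>D k\<close> and \<open>r * g\<close> are at most 1.\<close>

lemma rate_error:
  assumes "\<omega> \<in> space M" "k \<in> V"
  shows "\<bar>(D k)\<^sup>2 * r t \<omega> k - g t \<omega> k / (real (Suc t))\<^sup>2\<bar>
    \<le> \<bar>Z t \<omega> k\<bar> / (real (Suc t))\<^sup>2 + \<bar>Z t \<omega> k\<bar> * r t \<omega> k / real (Suc t) + 1 / (real (Suc t))\<^sup>2"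
proof -
  define T where "T = real (Suc t)"
  define G where "G = g t \<omega> k"
  define R where "R = r t \<omega> k"
  define z where "z = Z t \<omega> k"
  have T: "T > 0" by (simp add: T_def)
  have G: "G > 0" using weights_nonneg(3)[OF assms] by (simp add: G_def)
  have R: "R = 1 / (G + 1)" by (simp add: R_def r_def G_def)
  have R0: "R > 0" and RG: "R * G \<le> 1" using G unfolding R by (auto simp: field_simps)
  have z: "D k * T = G - z" by (simp add: z_def Z_def G_def T_def)
  have D: "0 \<le> D k" "D k \<le> 1" using D_pos[OF assms(2)] D_le_1 by auto
  have "T\<^sup>2 * ((D k)\<^sup>2 * R - G / T\<^sup>2) = R * ((D k * T)\<^sup>2 - G * (G + 1))"
  proof -
    have "R * (G * (G + 1)) = G" using G by (simp add: R)
    then show ?thesis using T by (simp add: right_diff_distrib power_mult_distrib)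
  qed
  also have "(D k * T)\<^sup>2 - G * (G + 1) = - (z * (D k * T) + z * G + G)"
    unfolding z by (simp add: power2_eq_square algebra_simps)
  finally have eq: "T\<^sup>2 * ((D k)\<^sup>2 * R - G / T\<^sup>2) = - (z * R * (D k * T) + z * (R * G) + R * G)"
    by (simp add: algebra_simps)
  have "T\<^sup>2 * \<bar>(D k)\<^sup>2 * R - G / T\<^sup>2\<bar> = \<bar>z * R * (D k * T) + z * (R * G) + R * G\<bar>"
    using arg_cong[OF eq, of abs] by (simp add: abs_mult)
  also have "\<dots> \<le> \<bar>z\<bar> * R * (D k * T) + \<bar>z\<bar> * (R * G) + R * G"
    using R0 G D T by (intro order.trans[OF abs_triangle_ineq] add_mono) (auto simp: abs_mult)
  also have "\<dots> \<le> \<bar>z\<bar> * R * (1 * T) + \<bar>z\<bar> * 1 + 1"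
    using R0 RG D T by (intro add_mono mult_left_mono mult_right_mono) auto
  finally show ?thesis
    using T unfolding T_def[symmetric] G_def[symmetric] R_def[symmetric] z_def[symmetric]
    by (simp add: field_simps power2_eq_square)
qed

text \<open>In mean square, \<open>Z\<close> has order sqrt T and \<open>r\<close> has order 1/T.
  With \<open>w\<close> the square root of T, weighted AM-GM splits every product so that only these
  second moments occur, and each term has mean of order w^(-3).\<close>

lemma expectation_noise:
  "\<exists>C. \<forall>t. (\<integral>\<omega>. (\<Sum>k\<in>V. noise t \<omega> k) \<partial>M) \<le> C / sqrt (Suc t) ^ 3"
proof -
  define c where "c k = 2 * ((u0 k + v0 k - D k)\<^sup>2 + 1) + 2 + 2 * ((16 + 32 * exp 1) / (D k)\<^sup>2)" for k
  have vertex: "(\<integral>\<omega>. noise t \<omega> k \<partial>M) \<le> c k / sqrt (Suc t) ^ 3" if k: "k \<in> V" for t k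
  proof -
    define w where "w = sqrt (Suc t)"
    define A where "A = (u0 k + v0 k - D k)\<^sup>2"
    define B where "B = (16 + 32 * exp (1 :: real)) / (D k)\<^sup>2"
    have w: "w \<ge> 1" by (simp add: w_def)
    have ww: "real (Suc t) = w\<^sup>2" by (simp add: w_def)
    have pointwise: "noise t \<omega> k \<le> 2 * (Z t \<omega> k)\<^sup>2 / w ^ 5 + 2 / w ^ 3 + 2 * w * (r t \<omega> k)\<^sup>2"
      if \<omega>: "\<omega> \<in> space M" for \<omega>
    proof -
      define z where "z = \<bar>Z t \<omega> k\<bar>"
      define R where "R = r t \<omega> k"
      have zR: "z \<ge> 0" "R > 0" using r_bounds[OF \<omega> k, of t] by (simp_all add: z_def R_def)
      have z2: "(Z t \<omega> k)\<^sup>2 = z\<^sup>2" by (simp add: z_def)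
      \<comment> \<open>To be divided by \<open>w ^ 5\<close>: since the mean of
        \<open>z\<^sup>2\<close> has order w^2, both summands then have order w^(-3).\<close>
      have "z * w \<le> z\<^sup>2 + w\<^sup>2"
        using sum_squares_bound[of z w] mult_nonneg_nonneg[of z w] w zR by linarith
      then have 1: "z / w ^ 4 \<le> z\<^sup>2 / w ^ 5 + 1 / w ^ 3"
        using w by (simp add: field_simps eval_nat_numeral)
      \<comment> \<open>The factor \<open>w ^ 3\<close> is chosen so that division by
        \<open>w ^ 5\<close> leaves \<open>w * R\<^sup>2\<close>, again of order w^(-3), as the mean
        of \<open>R\<^sup>2\<close> has order w^(-4).\<close>
      have "z * (R * w ^ 3) \<le> z\<^sup>2 + (R * w ^ 3)\<^sup>2"
        using sum_squares_bound[of z "R * w ^ 3"] mult_nonneg_nonneg[of z "R * w ^ 3"]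
          mult_nonneg_nonneg[of R "w ^ 3"] zero_le_power[of w 3] w zR by linarith
      then have 2: "z * R / w\<^sup>2 \<le> z\<^sup>2 / w ^ 5 + w * R\<^sup>2"
        using w by (simp add: field_simps eval_nat_numeral)
      have 3: "R\<^sup>2 \<le> w * R\<^sup>2" using w mult_right_mono[of 1 w "R\<^sup>2"] by simp
      have 4: "1 / w ^ 4 \<le> 1 / w ^ 3" using w by (simp add: frac_le power_increasing)
      have "noise t \<omega> k = z / w ^ 4 + z * R / w\<^sup>2 + R\<^sup>2 + 1 / w ^ 4"
        unfolding noise_def ww z_def R_def by (simp add: power_mult[symmetric])
      also have "\<dots> \<le> 2 * z\<^sup>2 / w ^ 5 + 2 / w ^ 3 + 2 * w * R\<^sup>2" using 1 2 3 4 by simp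
      finally show ?thesis unfolding z2 R_def .
    qed
    have "(\<integral>\<omega>. noise t \<omega> k \<partial>M) \<le> (\<integral>\<omega>. 2 * (Z t \<omega> k)\<^sup>2 / w ^ 5 + 2 / w ^ 3 + 2 * w * (r t \<omega> k)\<^sup>2 \<partial>M)"
      by (intro integral_mono past_integrable[of _ t] pointwise) (use k in measurable)
    also have "\<dots> = 2 * (\<integral>\<omega>. (Z t \<omega> k)\<^sup>2 \<partial>M) / w ^ 5 + 2 / w ^ 3 + 2 * w * (\<integral>\<omega>. (r t \<omega> k)\<^sup>2 \<partial>M)"
    proof -
      have "integrable M (\<lambda>\<omega>. (Z t \<omega> k)\<^sup>2)" "integrable M (\<lambda>\<omega>. (r t \<omega> k)\<^sup>2)"
        by (rule past_integrable[of _ t], use k in measurable)+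
      then show ?thesis by (simp add: prob_space)
    qed
    also have "\<dots> \<le> 2 * ((A + 1) * w\<^sup>2) / w ^ 5 + 2 / w ^ 3 + 2 * w * (B / (w\<^sup>2)\<^sup>2)"
    proof (intro add_mono mult_left_mono divide_right_mono order.refl)
      have "A + t \<le> (A + 1) * w\<^sup>2"
        unfolding ww[symmetric] by (simp add: algebra_simps A_def)
      then show "(\<integral>\<omega>. (Z t \<omega> k)\<^sup>2 \<partial>M) \<le> (A + 1) * w\<^sup>2"
        using expectation_Z_square[OF k, of t] unfolding A_def by linarith
      show "(\<integral>\<omega>. (r t \<omega> k)\<^sup>2 \<partial>M) \<le> B / (w\<^sup>2)\<^sup>2"
        using expectation_r_square[OF k, of t] unfolding B_def ww by (simp add: power_mult_distrib)
    qed (use w in auto)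
    also have "\<dots> = (2 * (A + 1) + 2 + 2 * B) / w ^ 3"
      using w by (simp add: field_simps eval_nat_numeral)
    finally show ?thesis unfolding c_def A_def B_def w_def .
  qed
  have "(\<integral>\<omega>. (\<Sum>k\<in>V. noise t \<omega> k) \<partial>M) \<le> (\<Sum>k\<in>V. c k) / sqrt (Suc t) ^ 3" for t
  proof -
    have "(\<integral>\<omega>. (\<Sum>k\<in>V. noise t \<omega> k) \<partial>M) = (\<Sum>k\<in>V. \<integral>\<omega>. noise t \<omega> k \<partial>M)"
      by (rule Bochner_Integration.integral_sum, rule past_integrable[of _ t]) measurable
    also have "\<dots> \<le> (\<Sum>k\<in>V. c k / sqrt (Suc t) ^ 3)"
      by (rule sum_mono[OF vertex])
    finally show ?thesis by (simp add: sum_divide_distrib)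
  qed
  then show ?thesis by blast
qed

section \<open>One-step drift of the quadratic functionals\<close>

definition next_share :: "nat \<Rightarrow> 'b set \<Rightarrow> bool \<Rightarrow> 'a \<Rightarrow> 'b \<Rightarrow> real" where
  "next_share t \<epsilon> b \<omega> k =
    (if k \<in> \<epsilon> then x t \<omega> k + (of_bool b - x t \<omega> k) * r t \<omega> k else x t \<omega> k)"

lemma past_next_share [measurable]:
  "k \<in> V \<Longrightarrow> (\<lambda>\<omega>. next_share t \<epsilon> b \<omega> k) \<in> borel_measurable (past t)"
  unfolding next_share_def by measurable

text \<open>With edge and outcome as separate arguments, the update becomes a family of
  past-measurable functions, the shape that \<open>integral_step\<close> takes.\<close>

lemma share_Suc:
  "\<omega> \<in> space M \<Longrightarrow> k \<in> V \<Longrightarrow> x (Suc t) \<omega> k = next_share t (e (Suc t) \<omega>) (agU (Suc t) \<omega>) \<omega> k"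
  using share_step[of \<omega> k t] by (simp add: next_share_def r_def)

lemma sum_vertices_edge:
  fixes a b :: "'b \<Rightarrow> real"
  assumes "\<epsilon> \<in> E"
  shows "(\<Sum>k\<in>V. if k \<in> \<epsilon> then b k + a k else b k) = (\<Sum>k\<in>V. b k) + (\<Sum>k\<in>\<epsilon>. a k)"
proof -
  have "(\<Sum>k\<in>V. if k \<in> \<epsilon> then b k + a k else b k) = (\<Sum>k\<in>V. b k + (if k \<in> \<epsilon> then a k else 0))"
    by (intro sum.cong) auto
  also have "\<dots> = (\<Sum>k\<in>V. b k) + (\<Sum>k\<in>V \<inter> \<epsilon>. a k)"
    using finite_V by (simp add: sum.distrib sum.inter_restrict)
  also have "V \<inter> \<epsilon> = \<epsilon>" using edge_subset[OF assms] by blast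
  finally show ?thesis .
qed

definition S :: "nat \<Rightarrow> 'a \<Rightarrow> real" where
  "S t \<omega> = (\<Sum>k\<in>V. (D k)\<^sup>2 * (x t \<omega> k)\<^sup>2)"

definition L :: "nat \<Rightarrow> 'a \<Rightarrow> real" where
  "L t \<omega> = (\<Sum>k\<in>V. (D k)\<^sup>2 * x t \<omega> k)"

definition dissipation :: "nat \<Rightarrow> 'a \<Rightarrow> real" where
  "dissipation t \<omega> = (\<Sum>\<epsilon>\<in>E. \<Sum>k\<in>\<epsilon>. (x t \<omega> k - p t \<omega> \<epsilon>)\<^sup>2)"

text \<open>Averaging a vertex sum over the edges weights vertex \<open>k\<close> by
  \<open>D k\<close>, at most 1; as \<open>f\<close> is nonnegative the weight may be
  dropped.\<close>

lemma step_mean_le: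
  assumes \<omega>: "\<omega> \<in> space M"
    and le: "\<And>\<epsilon>. \<epsilon> \<in> E \<Longrightarrow>
      p t \<omega> \<epsilon> * F \<epsilon> True \<omega> + (1 - p t \<omega> \<epsilon>) * F \<epsilon> False \<omega> \<le> c + G \<epsilon> + (\<Sum>k\<in>\<epsilon>. f k)"
    and f: "\<And>k. k \<in> V \<Longrightarrow> f k \<ge> 0"
  shows "step_mean t F \<omega> \<le> c + (\<Sum>\<epsilon>\<in>E. G \<epsilon>) / card E + (\<Sum>k\<in>V. f k)"
proof -
  have "step_mean t F \<omega> \<le> (\<Sum>\<epsilon>\<in>E. c + G \<epsilon> + (\<Sum>k\<in>\<epsilon>. f k)) / card E"
    unfolding step_mean_def by (intro divide_right_mono sum_mono le) auto
  also have "\<dots> = c + (\<Sum>\<epsilon>\<in>E. G \<epsilon>) / card E + (\<Sum>\<epsilon>\<in>E. \<Sum>k\<in>\<epsilon>. f k) / card E"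
    using card_E_pos by (simp add: sum.distrib add_divide_distrib)
  also have "(\<Sum>\<epsilon>\<in>E. \<Sum>k\<in>\<epsilon>. f k) / card E \<le> (\<Sum>k\<in>V. f k)"
    by (rule sum_edges_vertices_le[OF f])
  finally show ?thesis by simp
qed

lemma edge_in_V: "\<epsilon> \<in> E \<Longrightarrow> k \<in> \<epsilon> \<Longrightarrow> k \<in> V"
  using edge_subset by blast

text \<open>The rate \<open>(D k)\<^sup>2 * r\<close> is exchanged for \<open>g / T\<^sup>2\<close>
  at the cost \<theta>, and \<open>y * (q - y) = q * (q - y) - (y - q)\<^sup>2\<close>. When
  \<open>q\<close> is the edge share, the first part cancels over the endpoints by
  \<open>edge_balance\<close>; the second part is the dissipation.\<close>

lemma square_drift_vertex:
  assumes \<omega>: "\<omega> \<in> space M" and k: "k \<in> V" and q: "0 \<le> q" "q \<le> 1"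
  shows "2 * (D k)\<^sup>2 * r t \<omega> k * x t \<omega> k * (q - x t \<omega> k) + (D k)\<^sup>2 * (r t \<omega> k)\<^sup>2
    \<le> 2 / (real (Suc t))\<^sup>2 * q * (g t \<omega> k * (q - x t \<omega> k))
      - 2 / (card E * real (Suc t)) * (x t \<omega> k - q)\<^sup>2 + 4 * noise t \<omega> k"
proof -
  define T where "T = real (Suc t)"
  define G where "G = g t \<omega> k"
  define R where "R = r t \<omega> k"
  define z where "z = Z t \<omega> k"
  define y where "y = x t \<omega> k"
  define \<theta> where "\<theta> = (D k)\<^sup>2 * R - G / T\<^sup>2"
  have T: "T > 0" by (simp add: T_def)
  have y: "0 \<le> y" "y \<le> 1" using share_bounds[OF \<omega> k] by (simp_all add: y_def)
  have R: "R > 0" using r_bounds[OF \<omega> k] by (simp add: R_def)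
  have \<theta>: "\<bar>\<theta>\<bar> \<le> \<bar>z\<bar> / T\<^sup>2 + \<bar>z\<bar> * R / T + 1 / T\<^sup>2"
    using rate_error[OF \<omega> k, of t] unfolding \<theta>_def G_def R_def T_def z_def .
  have sq1: "(y - q)\<^sup>2 \<le> 1" using y q by (simp add: abs_square_le_1)
  have "\<bar>y * (q - y)\<bar> \<le> 1"
    unfolding abs_mult using mult_mono[of "\<bar>y\<bar>" 1 "\<bar>q - y\<bar>" 1] y q by simp
  then have e1: "2 * \<theta> * (y * (q - y)) \<le> 2 * \<bar>\<theta>\<bar>"
    using mult_left_mono[of "\<bar>y * (q - y)\<bar>" 1 "2 * \<bar>\<theta>\<bar>"] abs_ge_self[of "2 * \<theta> * (y * (q - y))"]
    by (simp add: abs_mult)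
  \<comment> \<open>Since \<open>G = D k * T + z\<close>, the bound
    \<open>D k \<ge> 1 / card E\<close> makes the loss
    \<open>G * (y - q)\<^sup>2 / T\<^sup>2\<close> of order 1/T times the square, up to an error in
    \<open>\<bar>z\<bar>\<close>.\<close>
  have "1 / card E * T \<le> D k * T" using D_ge[OF k] T by (intro mult_right_mono) auto
  then have "T / card E - \<bar>z\<bar> \<le> G" by (simp add: z_def Z_def G_def T_def)
  then have "(T / card E - \<bar>z\<bar>) * (y - q)\<^sup>2 \<le> G * (y - q)\<^sup>2" by (rule mult_right_mono) simp
  moreover have "\<bar>z\<bar> * (y - q)\<^sup>2 \<le> \<bar>z\<bar> * 1" by (intro mult_left_mono sq1) simp
  ultimately have "T / card E * (y - q)\<^sup>2 - \<bar>z\<bar> \<le> G * (y - q)\<^sup>2" by (simp add: left_diff_distrib)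
  then have "2 / T\<^sup>2 * (T / card E * (y - q)\<^sup>2 - \<bar>z\<bar>) \<le> 2 / T\<^sup>2 * (G * (y - q)\<^sup>2)"
    by (rule mult_left_mono) simp
  moreover have "2 / T\<^sup>2 * (T / card E * s - c) = 2 / (card E * T) * s - 2 * c / T\<^sup>2" for s c
    using T card_E_pos by (simp add: field_simps power2_eq_square)
  ultimately have e2: "2 / (card E * T) * (y - q)\<^sup>2 - 2 * \<bar>z\<bar> / T\<^sup>2 \<le> 2 / T\<^sup>2 * (G * (y - q)\<^sup>2)"
    by simp
  have "(D k)\<^sup>2 \<le> 1" using D_pos[OF k] D_le_1[of k] by (simp add: abs_square_le_1)
  then have e3: "(D k)\<^sup>2 * R\<^sup>2 \<le> R\<^sup>2" using mult_right_mono[of "(D k)\<^sup>2" 1 "R\<^sup>2"] by simp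
  have "2 * (D k)\<^sup>2 * R * y * (q - y) = 2 * \<theta> * (y * (q - y)) + 2 / T\<^sup>2 * q * (G * (q - y)) - 2 / T\<^sup>2 * (G * (y - q)\<^sup>2)"
    unfolding \<theta>_def using T by (simp add: field_simps power2_eq_square)
  then have "2 * (D k)\<^sup>2 * R * y * (q - y) + (D k)\<^sup>2 * R\<^sup>2 \<le>
    2 / T\<^sup>2 * q * (G * (q - y)) - 2 / (card E * T) * (y - q)\<^sup>2 + (2 * \<bar>z\<bar> / T\<^sup>2 + 2 * \<bar>\<theta>\<bar> + R\<^sup>2)"
    using e1 e2 e3 by linarith
  \<comment> \<open>The 4 is forced by \<open>\<bar>z\<bar> / T\<^sup>2\<close>, which occurs twice
    from \<open>e2\<close> and twice from \<theta>.\<close>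
  moreover have "2 * \<bar>z\<bar> / T\<^sup>2 + 2 * \<bar>\<theta>\<bar> + R\<^sup>2 \<le> 4 * (\<bar>z\<bar> / T\<^sup>2 + \<bar>z\<bar> * R / T + R\<^sup>2 + 1 / T\<^sup>2)"
  proof -
    have "\<bar>z\<bar> / T\<^sup>2 \<ge> 0" "\<bar>z\<bar> * R / T \<ge> 0" "R\<^sup>2 \<ge> 0" "1 / T\<^sup>2 \<ge> 0" using T R by auto
    moreover have "2 * \<bar>z\<bar> / T\<^sup>2 = 2 * (\<bar>z\<bar> / T\<^sup>2)" by simp
    ultimately show ?thesis using \<theta> by (simp only: distrib_left) linarith
  qed
  ultimately show ?thesis
    unfolding noise_def T_def[symmetric] G_def[symmetric] R_def[symmetric] z_def[symmetric] y_def[symmetric]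
    by linarith
qed

text \<open>At each endpoint the averaged increment of the weighted square has a first-order part
  and a second-order part of at most \<open>(D k)\<^sup>2 * r\<^sup>2\<close>.
  \<open>square_drift_vertex\<close> treats both, and \<open>edge_balance\<close> removes the terms
  proportional to \<open>q\<close>.\<close>

lemma square_drift:
  assumes \<omega>: "\<omega> \<in> space M"
  shows "step_mean t (\<lambda>\<epsilon> b \<omega>. \<Sum>k\<in>V. (D k)\<^sup>2 * (next_share t \<epsilon> b \<omega> k)\<^sup>2) \<omega>
    \<le> S t \<omega> - 2 / ((card E)\<^sup>2 * real (Suc t)) * dissipation t \<omega> + 4 * (\<Sum>k\<in>V. noise t \<omega> k)"
proof -
  define F where "F \<epsilon> b \<omega> = (\<Sum>k\<in>V. (D k)\<^sup>2 * (next_share t \<epsilon> b \<omega> k)\<^sup>2)" for \<epsilon> b \<omega>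
  let ?c = "2 / (card E * real (Suc t))"
  have "step_mean t F \<omega> \<le> S t \<omega> + (\<Sum>\<epsilon>\<in>E. - ?c * (\<Sum>k\<in>\<epsilon>. (x t \<omega> k - p t \<omega> \<epsilon>)\<^sup>2)) / card E
    + (\<Sum>k\<in>V. 4 * noise t \<omega> k)"
  proof (rule step_mean_le[OF \<omega>])
    fix \<epsilon> assume \<epsilon>: "\<epsilon> \<in> E"
    define q where "q = p t \<omega> \<epsilon>"
    have q: "0 \<le> q" "q \<le> 1" using edge_share_bounds[OF \<omega> \<epsilon>] by (simp_all add: q_def)
    define a where "a b k = (D k)\<^sup>2 * (2 * x t \<omega> k * (of_bool b - x t \<omega> k) * r t \<omega> k
      + (of_bool b - x t \<omega> k)\<^sup>2 * (r t \<omega> k)\<^sup>2)" for b k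
    have F: "F \<epsilon> b \<omega> = S t \<omega> + (\<Sum>k\<in>\<epsilon>. a b k)" for b
    proof -
      have "F \<epsilon> b \<omega> = (\<Sum>k\<in>V. if k \<in> \<epsilon> then (D k)\<^sup>2 * (x t \<omega> k)\<^sup>2 + a b k else (D k)\<^sup>2 * (x t \<omega> k)\<^sup>2)"
        unfolding F_def a_def next_share_def by (intro sum.cong) (auto simp: power2_eq_square algebra_simps)
      then show ?thesis unfolding S_def by (simp add: sum_vertices_edge[OF \<epsilon>])
    qed
    have vertex: "q * a True k + (1 - q) * a False k \<le> 2 / (real (Suc t))\<^sup>2 * q * (g t \<omega> k * (q - x t \<omega> k))
      + (- ?c * (x t \<omega> k - q)\<^sup>2 + 4 * noise t \<omega> k)" if k: "k \<in> \<epsilon>" for k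
    proof -
      have kV: "k \<in> V" using edge_in_V \<epsilon> k .
      define y where "y = x t \<omega> k"
      have y: "0 \<le> y" "y \<le> 1" using share_bounds[OF \<omega> kV] by (simp_all add: y_def)
      have "q * (1 - y)\<^sup>2 + (1 - q) * y\<^sup>2 \<le> q * 1 + (1 - q) * 1"
        using y q by (intro add_mono mult_left_mono) (auto simp: power_le_one)
      then have "(D k)\<^sup>2 * (r t \<omega> k)\<^sup>2 * (q * (1 - y)\<^sup>2 + (1 - q) * y\<^sup>2) \<le> (D k)\<^sup>2 * (r t \<omega> k)\<^sup>2 * 1"
        by (intro mult_left_mono) auto
      moreover have "q * a True k + (1 - q) * a False k = 2 * (D k)\<^sup>2 * r t \<omega> k * y * (q - y)
        + (D k)\<^sup>2 * (r t \<omega> k)\<^sup>2 * (q * (1 - y)\<^sup>2 + (1 - q) * y\<^sup>2)"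
        unfolding a_def y_def[symmetric] by (simp add: power2_eq_square algebra_simps)
      ultimately show ?thesis
        using square_drift_vertex[OF \<omega> kV q, of t] unfolding y_def by linarith
    qed
    have "q * (\<Sum>k\<in>\<epsilon>. a True k) + (1 - q) * (\<Sum>k\<in>\<epsilon>. a False k)
      = (\<Sum>k\<in>\<epsilon>. q * a True k + (1 - q) * a False k)"
      by (simp add: sum.distrib sum_distrib_left)
    also have "\<dots> \<le> (\<Sum>k\<in>\<epsilon>. 2 / (real (Suc t))\<^sup>2 * q * (g t \<omega> k * (q - x t \<omega> k))
      + (- ?c * (x t \<omega> k - q)\<^sup>2 + 4 * noise t \<omega> k))"
      by (rule sum_mono[OF vertex])
    also have "\<dots> = 2 / (real (Suc t))\<^sup>2 * q * (\<Sum>k\<in>\<epsilon>. g t \<omega> k * (q - x t \<omega> k))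
      + (- ?c * (\<Sum>k\<in>\<epsilon>. (x t \<omega> k - q)\<^sup>2) + (\<Sum>k\<in>\<epsilon>. 4 * noise t \<omega> k))"
      by (simp only: sum.distrib sum_distrib_left)
    also have "\<dots> = - ?c * (\<Sum>k\<in>\<epsilon>. (x t \<omega> k - q)\<^sup>2) + (\<Sum>k\<in>\<epsilon>. 4 * noise t \<omega> k)"
      using edge_balance[OF \<omega> \<epsilon>, of t] by (simp add: q_def)
    finally have "q * (\<Sum>k\<in>\<epsilon>. a True k) + (1 - q) * (\<Sum>k\<in>\<epsilon>. a False k)
      \<le> - ?c * (\<Sum>k\<in>\<epsilon>. (x t \<omega> k - q)\<^sup>2) + (\<Sum>k\<in>\<epsilon>. 4 * noise t \<omega> k)" .
    moreover have "p t \<omega> \<epsilon> * F \<epsilon> True \<omega> + (1 - p t \<omega> \<epsilon>) * F \<epsilon> False \<omega>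
      = S t \<omega> + (q * (\<Sum>k\<in>\<epsilon>. a True k) + (1 - q) * (\<Sum>k\<in>\<epsilon>. a False k))"
      unfolding F q_def by (simp add: algebra_simps)
    ultimately show "p t \<omega> \<epsilon> * F \<epsilon> True \<omega> + (1 - p t \<omega> \<epsilon>) * F \<epsilon> False \<omega>
      \<le> S t \<omega> + - ?c * (\<Sum>k\<in>\<epsilon>. (x t \<omega> k - p t \<omega> \<epsilon>)\<^sup>2) + (\<Sum>k\<in>\<epsilon>. 4 * noise t \<omega> k)"
      unfolding q_def by linarith
  qed (use noise_nonneg[OF \<omega>] in simp)
  \<comment> \<open>One factor \<open>card E\<close> comes from the lower bound on \<open>D\<close>,
    the other from averaging over the edges.\<close>
  moreover have "(\<Sum>\<epsilon>\<in>E. - ?c * (\<Sum>k\<in>\<epsilon>. (x t \<omega> k - p t \<omega> \<epsilon>)\<^sup>2)) / card E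
    = - (2 / ((card E)\<^sup>2 * real (Suc t)) * dissipation t \<omega>)"
    unfolding dissipation_def sum_distrib_left[symmetric] by (simp add: power2_eq_square)
  ultimately show ?thesis unfolding F_def sum_distrib_left by linarith
qed

text \<open>The reference point \<open>z\<close> stays free: 0 gives the mean square of
  \<open>L\<close>, an earlier value of \<open>L\<close> gives increments. In the noise factor,
  \<open>2 * card V\<close> bounds the cross term of \<open>L - z\<close> with the drift, and 2 the
  squared increment.\<close>

lemma linear_drift:
  assumes \<omega>: "\<omega> \<in> space M" and z: "\<bar>L t \<omega> - z\<bar> \<le> card V"
  shows "step_mean t (\<lambda>\<epsilon> b \<omega>. ((\<Sum>k\<in>V. (D k)\<^sup>2 * next_share t \<epsilon> b \<omega> k) - z)\<^sup>2) \<omega>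
    \<le> (L t \<omega> - z)\<^sup>2 + (2 * real (card V) + 2) * (\<Sum>k\<in>V. noise t \<omega> k)"
proof -
  define F where "F \<epsilon> b \<omega> = ((\<Sum>k\<in>V. (D k)\<^sup>2 * next_share t \<epsilon> b \<omega> k) - z)\<^sup>2" for \<epsilon> b \<omega>
  let ?n = "real (card V)"
  have "step_mean t F \<omega> \<le> (L t \<omega> - z)\<^sup>2 + (\<Sum>\<epsilon>\<in>E. 0) / card E + (\<Sum>k\<in>V. (2 * ?n + 2) * noise t \<omega> k)"
  proof (rule step_mean_le[OF \<omega>])
    fix \<epsilon> assume \<epsilon>: "\<epsilon> \<in> E"
    define q where "q = p t \<omega> \<epsilon>"
    have q: "0 \<le> q" "q \<le> 1" using edge_share_bounds[OF \<omega> \<epsilon>] by (simp_all add: q_def)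
    define a where "a b k = (D k)\<^sup>2 * ((of_bool b - x t \<omega> k) * r t \<omega> k)" for b k
    define d where "d = (\<Sum>k\<in>\<epsilon>. (D k)\<^sup>2 * r t \<omega> k * (q - x t \<omega> k))"
    have F: "F \<epsilon> b \<omega> = (L t \<omega> - z + (\<Sum>k\<in>\<epsilon>. a b k))\<^sup>2" for b
    proof -
      have "(\<Sum>k\<in>V. (D k)\<^sup>2 * next_share t \<epsilon> b \<omega> k)
        = (\<Sum>k\<in>V. if k \<in> \<epsilon> then (D k)\<^sup>2 * x t \<omega> k + a b k else (D k)\<^sup>2 * x t \<omega> k)"
        unfolding a_def next_share_def by (intro sum.cong) (auto simp: algebra_simps)
      then show ?thesis unfolding L_def F_def by (simp add: sum_vertices_edge[OF \<epsilon>] algebra_simps)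
    qed
    have D2: "(D k)\<^sup>2 \<le> 1" if "k \<in> V" for k
      using D_pos[OF that] D_le_1[of k] by (simp add: abs_square_le_1)
    \<comment> \<open>Cauchy-Schwarz over the two endpoints of \<epsilon>.\<close>
    have square: "(\<Sum>k\<in>\<epsilon>. a b k)\<^sup>2 \<le> 2 * (\<Sum>k\<in>\<epsilon>. (r t \<omega> k)\<^sup>2)" for b
    proof -
      have "(\<Sum>k\<in>\<epsilon>. a b k)\<^sup>2 \<le> (\<Sum>k\<in>\<epsilon>. (a b k)\<^sup>2) * card \<epsilon>"
        by (rule sum_squared_le_sum_of_squares)
      also have "(\<Sum>k\<in>\<epsilon>. (a b k)\<^sup>2) \<le> (\<Sum>k\<in>\<epsilon>. (r t \<omega> k)\<^sup>2)"
      proof (rule sum_mono)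
        fix k assume "k \<in> \<epsilon>"
        then have k: "k \<in> V" by (rule edge_in_V[OF \<epsilon>])
        have "\<bar>of_bool b - x t \<omega> k\<bar> \<le> 1" using share_bounds[OF \<omega> k, of t] by auto
        then have "\<bar>a b k\<bar> \<le> 1 * (1 * r t \<omega> k)"
          unfolding a_def abs_mult using r_bounds[OF \<omega> k, of t] D2[OF k] by (intro mult_mono) auto
        then show "(a b k)\<^sup>2 \<le> (r t \<omega> k)\<^sup>2"
          using power_mono[of "\<bar>a b k\<bar>" "r t \<omega> k" 2] by simp
      qed
      finally show ?thesis using card_edge[OF \<epsilon>] by simp
    qed
    \<comment> \<open>Subtracting \<open>g / T\<^sup>2\<close> from the rate leaves \<open>d\<close>
      unchanged, because these terms sum to zero over the edge; only the rate error remains.\<close>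
    have "d = (\<Sum>k\<in>\<epsilon>. ((D k)\<^sup>2 * r t \<omega> k - g t \<omega> k / (real (Suc t))\<^sup>2) * (q - x t \<omega> k))
      + 1 / (real (Suc t))\<^sup>2 * (\<Sum>k\<in>\<epsilon>. g t \<omega> k * (q - x t \<omega> k))"
      unfolding d_def sum_distrib_left sum.distrib[symmetric]
      by (intro sum.cong) (simp_all add: left_diff_distrib)
    then have "d = (\<Sum>k\<in>\<epsilon>. ((D k)\<^sup>2 * r t \<omega> k - g t \<omega> k / (real (Suc t))\<^sup>2) * (q - x t \<omega> k))"
      using edge_balance[OF \<omega> \<epsilon>, of t] by (simp add: q_def)
    then have "\<bar>d\<bar> \<le> (\<Sum>k\<in>\<epsilon>. \<bar>((D k)\<^sup>2 * r t \<omega> k - g t \<omega> k / (real (Suc t))\<^sup>2) * (q - x t \<omega> k)\<bar>)"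
      by simp
    \<comment> \<open>Three of the four noise terms absorb the rate error. Setting the fourth aside
      lets the same estimate yield \<open>r_le\<close> for the squared increments.\<close>
    also have "\<dots> \<le> (\<Sum>k\<in>\<epsilon>. noise t \<omega> k - (r t \<omega> k)\<^sup>2)"
    proof (rule sum_mono)
      fix k assume "k \<in> \<epsilon>"
      then have k: "k \<in> V" by (rule edge_in_V[OF \<epsilon>])
      have "\<bar>q - x t \<omega> k\<bar> \<le> 1" using share_bounds[OF \<omega> k, of t] q by auto
      then have "\<bar>((D k)\<^sup>2 * r t \<omega> k - g t \<omega> k / (real (Suc t))\<^sup>2) * (q - x t \<omega> k)\<bar>
        \<le> \<bar>(D k)\<^sup>2 * r t \<omega> k - g t \<omega> k / (real (Suc t))\<^sup>2\<bar> * 1"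
        unfolding abs_mult by (rule mult_left_mono) simp
      also have "\<dots> \<le> noise t \<omega> k - (r t \<omega> k)\<^sup>2"
        unfolding noise_def mult_1_right by (rule order.trans[OF rate_error[OF \<omega> k, of t]]) simp
      finally show "\<bar>((D k)\<^sup>2 * r t \<omega> k - g t \<omega> k / (real (Suc t))\<^sup>2) * (q - x t \<omega> k)\<bar>
        \<le> noise t \<omega> k - (r t \<omega> k)\<^sup>2" .
    qed
    finally have d: "\<bar>d\<bar> \<le> (\<Sum>k\<in>\<epsilon>. noise t \<omega> k) - (\<Sum>k\<in>\<epsilon>. (r t \<omega> k)\<^sup>2)"
      by (simp add: sum_subtractf)
    have "2 * ((L t \<omega> - z) * d) \<le> 2 * (\<bar>L t \<omega> - z\<bar> * \<bar>d\<bar>)"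
      using abs_ge_self[of "(L t \<omega> - z) * d"] by (simp add: abs_mult)
    also have "\<dots> \<le> 2 * (?n * (\<Sum>k\<in>\<epsilon>. noise t \<omega> k))"
    proof -
      have "(\<Sum>k\<in>\<epsilon>. (r t \<omega> k)\<^sup>2) \<ge> 0" by (simp add: sum_nonneg)
      then show ?thesis using z d by (intro mult_left_mono mult_mono) auto
    qed
    finally have cross: "2 * ((L t \<omega> - z) * d) \<le> 2 * ?n * (\<Sum>k\<in>\<epsilon>. noise t \<omega> k)" by simp
    have r_le: "(\<Sum>k\<in>\<epsilon>. (r t \<omega> k)\<^sup>2) \<le> (\<Sum>k\<in>\<epsilon>. noise t \<omega> k)" using d by linarith
    have d_eq: "q * (\<Sum>k\<in>\<epsilon>. a True k) + (1 - q) * (\<Sum>k\<in>\<epsilon>. a False k) = d"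
      unfolding d_def a_def sum_distrib_left sum.distrib[symmetric]
      by (intro sum.cong) (auto simp: algebra_simps)
    have "q * (L t \<omega> - z + A)\<^sup>2 + (1 - q) * (L t \<omega> - z + B)\<^sup>2 = (L t \<omega> - z)\<^sup>2
      + 2 * ((L t \<omega> - z) * (q * A + (1 - q) * B)) + (q * A\<^sup>2 + (1 - q) * B\<^sup>2)" for A B :: real
      by (simp add: power2_eq_square algebra_simps)
    then have "p t \<omega> \<epsilon> * F \<epsilon> True \<omega> + (1 - p t \<omega> \<epsilon>) * F \<epsilon> False \<omega> = (L t \<omega> - z)\<^sup>2
      + 2 * ((L t \<omega> - z) * d) + (q * (\<Sum>k\<in>\<epsilon>. a True k)\<^sup>2 + (1 - q) * (\<Sum>k\<in>\<epsilon>. a False k)\<^sup>2)"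
      unfolding F q_def[symmetric] d_eq[symmetric] by blast
    also have "\<dots> \<le> (L t \<omega> - z)\<^sup>2 + 2 * ?n * (\<Sum>k\<in>\<epsilon>. noise t \<omega> k)
      + (q * (2 * (\<Sum>k\<in>\<epsilon>. noise t \<omega> k)) + (1 - q) * (2 * (\<Sum>k\<in>\<epsilon>. noise t \<omega> k)))"
      using cross square[of True] square[of False] r_le q
      by (intro add_mono mult_left_mono order.refl) linarith+
    also have "\<dots> = (L t \<omega> - z)\<^sup>2 + 0 + (\<Sum>k\<in>\<epsilon>. (2 * ?n + 2) * noise t \<omega> k)"
      unfolding sum_distrib_left[symmetric] by (simp add: algebra_simps)
    finally show "p t \<omega> \<epsilon> * F \<epsilon> True \<omega> + (1 - p t \<omega> \<epsilon>) * F \<epsilon> False \<omega>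
      \<le> (L t \<omega> - z)\<^sup>2 + 0 + (\<Sum>k\<in>\<epsilon>. (2 * ?n + 2) * noise t \<omega> k)" .
  qed (use noise_nonneg[OF \<omega>] in simp)
  then show ?thesis unfolding F_def sum_distrib_left[symmetric] by simp
qed

subsection \<open>Convergence\<close>

text \<open>A history determines its prefixes.\<close>

lemma past_mono:
  fixes X :: "'a \<Rightarrow> real"
  assumes "s \<le> t" and X: "X \<in> borel_measurable (past s)"
  shows "X \<in> borel_measurable (past t)"
  using assms(1)
proof (induction t rule: dec_induct)
  case (step t)
  then show ?case unfolding past_measurable_iff history_Suc append1_eq_conv by blast
qed (rule X)

lemma past_S [measurable]: "S t \<in> borel_measurable (past t)"
  unfolding S_def[abs_def] by measurable

lemma past_L [measurable]: "L t \<in> borel_measurable (past t)"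
  unfolding L_def[abs_def] by measurable

lemma past_dissipation [measurable]: "dissipation t \<in> borel_measurable (past t)"
proof -
  have [measurable]: "(\<lambda>\<omega>. x t \<omega> k) \<in> borel_measurable (past t)" if "\<epsilon> \<in> E" "k \<in> \<epsilon>" for \<epsilon> k
    using past_x edge_in_V that by blast
  show ?thesis unfolding dissipation_def[abs_def] by measurable
qed

definition mass :: real where
  "mass = (\<Sum>k\<in>V. (D k)\<^sup>2)"

lemma V_nonempty: "V \<noteq> {}"
  using connected by (simp add: connected_graph_def)

lemma mass_pos: "mass > 0"
  unfolding mass_def using V_nonempty finite_V by (intro sum_pos zero_less_power D_pos)

lemma mass_le: "mass \<le> card V"
proof -
  have "mass \<le> (\<Sum>k\<in>V. 1)"
    unfolding mass_def
  proof (rule sum_mono)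
    fix k assume "k \<in> V"
    then show "(D k)\<^sup>2 \<le> 1" using D_pos[of k] D_le_1[of k] by (simp add: abs_square_le_1)
  qed
  then show ?thesis by simp
qed

lemma L_bounds:
  assumes "\<omega> \<in> space M"
  shows "0 \<le> L t \<omega>" and "L t \<omega> \<le> mass"
proof -
  show "0 \<le> L t \<omega>" unfolding L_def using share_bounds[OF assms] by (intro sum_nonneg) auto
  show "L t \<omega> \<le> mass"
    unfolding L_def mass_def using share_bounds[OF assms] by (intro sum_mono mult_left_le) auto
qed

section \<open>Expected one-step inequalities and the limit of \<open>L\<close>\<close>

definition total_noise :: "nat \<Rightarrow> real" where
  "total_noise t = (\<integral>\<omega>. (\<Sum>k\<in>V. noise t \<omega> k) \<partial>M)"

lemma total_noise_nonneg: "total_noise t \<ge> 0"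
  unfolding total_noise_def by (intro integral_nonneg_AE AE_I2 sum_nonneg noise_nonneg)

lemma summable_total_noise: "summable total_noise"
proof -
  obtain C where "\<And>t. total_noise t \<le> C / sqrt (Suc t) ^ 3"
    using expectation_noise unfolding total_noise_def by blast
  then show ?thesis
    by (intro summable_comparison_test[OF _ summable_inverse_sqrt_cube[of C]])
      (auto simp: total_noise_nonneg)
qed

lemma expectation_S_step:
  "(\<integral>\<omega>. S (Suc t) \<omega> \<partial>M) \<le> (\<integral>\<omega>. S t \<omega> \<partial>M)
    - 2 / ((card E)\<^sup>2 * real (Suc t)) * (\<integral>\<omega>. dissipation t \<omega> \<partial>M) + 4 * total_noise t"
proof -
  let ?F = "\<lambda>\<epsilon> b \<omega>. \<Sum>k\<in>V. (D k)\<^sup>2 * (next_share t \<epsilon> b \<omega> k)\<^sup>2"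
  let ?c = "2 / ((card E)\<^sup>2 * real (Suc t))"
  have F: "?F \<epsilon> b \<in> borel_measurable (past t)" for \<epsilon> b by measurable
  have "(\<integral>\<omega>. S (Suc t) \<omega> \<partial>M) = (\<integral>\<omega>. ?F (e (Suc t) \<omega>) (agU (Suc t) \<omega>) \<omega> \<partial>M)"
    by (intro Bochner_Integration.integral_cong) (auto simp: S_def share_Suc)
  also have "\<dots> = (\<integral>\<omega>. step_mean t ?F \<omega> \<partial>M)" by (rule integral_step[OF F])
  also have "\<dots> \<le> (\<integral>\<omega>. S t \<omega> - ?c * dissipation t \<omega> + 4 * (\<Sum>k\<in>V. noise t \<omega> k) \<partial>M)"
    by (intro integral_mono past_integrable[of _ t] past_step_mean F square_drift) measurable
  also have "\<dots> = (\<integral>\<omega>. S t \<omega> \<partial>M) - ?c * (\<integral>\<omega>. dissipation t \<omega> \<partial>M) + 4 * total_noise t"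
  proof -
    have [simp]: "integrable M (S t)" "integrable M (dissipation t)"
      "integrable M (\<lambda>\<omega>. \<Sum>k\<in>V. noise t \<omega> k)"
      by (rule past_integrable[of _ t], measurable)+
    show ?thesis unfolding total_noise_def by simp
  qed
  finally show ?thesis .
qed

lemma expectation_L_step:
  assumes z: "z \<in> borel_measurable (past t)"
    and bounds: "\<And>\<omega>. \<omega> \<in> space M \<Longrightarrow> 0 \<le> z \<omega> \<and> z \<omega> \<le> mass"
  shows "(\<integral>\<omega>. (L (Suc t) \<omega> - z \<omega>)\<^sup>2 \<partial>M)
    \<le> (\<integral>\<omega>. (L t \<omega> - z \<omega>)\<^sup>2 \<partial>M) + (2 * real (card V) + 2) * total_noise t"
proof -
  let ?F = "\<lambda>\<epsilon> b \<omega>. ((\<Sum>k\<in>V. (D k)\<^sup>2 * next_share t \<epsilon> b \<omega> k) - z \<omega>)\<^sup>2"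
  have F: "?F \<epsilon> b \<in> borel_measurable (past t)" for \<epsilon> b using z by measurable
  have drift: "step_mean t ?F \<omega> \<le> (L t \<omega> - z \<omega>)\<^sup>2 + (2 * real (card V) + 2) * (\<Sum>k\<in>V. noise t \<omega> k)"
    if \<omega>: "\<omega> \<in> space M" for \<omega>
  proof -
    have "\<bar>L t \<omega> - z \<omega>\<bar> \<le> card V" using L_bounds[OF \<omega>, of t] bounds[OF \<omega>] mass_le by auto
    \<comment> \<open>\<open>step_mean\<close> evaluates its integrand at the given outcome only, so
      the random reference point acts as the number \<open>z \<omega>\<close>.\<close>
    from linear_drift[OF \<omega> this] show ?thesis by (simp add: step_mean_def)
  qed
  have "(\<integral>\<omega>. (L (Suc t) \<omega> - z \<omega>)\<^sup>2 \<partial>M) = (\<integral>\<omega>. ?F (e (Suc t) \<omega>) (agU (Suc t) \<omega>) \<omega> \<partial>M)"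
    by (intro Bochner_Integration.integral_cong) (auto simp: L_def share_Suc)
  also have "\<dots> = (\<integral>\<omega>. step_mean t ?F \<omega> \<partial>M)" by (rule integral_step[OF F])
  also have "\<dots> \<le> (\<integral>\<omega>. (L t \<omega> - z \<omega>)\<^sup>2 + (2 * real (card V) + 2) * (\<Sum>k\<in>V. noise t \<omega> k) \<partial>M)"
    by (intro integral_mono past_integrable[of _ t] past_step_mean F drift) (use z in measurable)
  also have "\<dots> = (\<integral>\<omega>. (L t \<omega> - z \<omega>)\<^sup>2 \<partial>M) + (2 * real (card V) + 2) * total_noise t"
  proof -
    have [simp]: "integrable M (\<lambda>\<omega>. (L t \<omega> - z \<omega>)\<^sup>2)" "integrable M (\<lambda>\<omega>. \<Sum>k\<in>V. noise t \<omega> k)"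
      by (rule past_integrable[of _ t], use z in measurable)+
    show ?thesis unfolding total_noise_def by simp
  qed
  finally show ?thesis .
qed

text \<open>\<open>L s\<close> belongs to the past of every later time, so it can serve as fixed
  reference point in each step. The resulting bound is a tail of a convergent series, uniform in
  \<open>t\<close>.\<close>

lemma expectation_L_increment:
  assumes "s \<le> t"
  shows "(\<integral>\<omega>. (L t \<omega> - L s \<omega>)\<^sup>2 \<partial>M) \<le> (2 * real (card V) + 2) * (\<Sum>i. total_noise (i + s))"
proof -
  have "(\<integral>\<omega>. (L t \<omega> - L s \<omega>)\<^sup>2 \<partial>M) \<le> (2 * real (card V) + 2) * (\<Sum>i<t - s. total_noise (i + s))"
    using assms
  proof (induction t rule: dec_induct)
    case (step t)
    have "(\<integral>\<omega>. (L (Suc t) \<omega> - L s \<omega>)\<^sup>2 \<partial>M)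
      \<le> (\<integral>\<omega>. (L t \<omega> - L s \<omega>)\<^sup>2 \<partial>M) + (2 * real (card V) + 2) * total_noise t"
      using L_bounds by (intro expectation_L_step past_mono[OF step(1) past_L]) auto
    then show ?case using step by (simp add: Suc_diff_le algebra_simps)
  qed simp
  also have "\<dots> \<le> (2 * real (card V) + 2) * (\<Sum>i. total_noise (i + s))"
    using summable_total_noise total_noise_nonneg
    by (intro mult_left_mono sum_le_suminf) (auto simp: summable_iff_shift)
  finally show ?thesis .
qed

lemma tail_noise_tendsto_0: "(\<lambda>s. \<Sum>i. total_noise (i + s)) \<longlonglongrightarrow> 0"
proof (rule LIMSEQ_I)
  fix \<delta> :: real assume "\<delta> > 0"
  from suminf_exist_split[OF this summable_total_noise]
  show "\<exists>N. \<forall>n\<ge>N. norm ((\<Sum>i. total_noise (i + n)) - 0) < \<delta>" by simp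
qed

text \<open>\<open>L\<close> is Cauchy in mean square, hence in mean, so a subsequence converges
  almost everywhere. Boundedness of \<open>L\<close> then carries the mean square estimate over to
  the limit.\<close>

lemma L_convergent:
  obtains X where "X \<in> borel_measurable M" "AE \<omega> in M. 0 \<le> X \<omega> \<and> X \<omega> \<le> mass"
    "(\<lambda>t. \<integral>\<omega>. (L t \<omega> - X \<omega>)\<^sup>2 \<partial>M) \<longlonglongrightarrow> 0"
proof -
  let ?c = "2 * real (card V) + 2"
  define \<tau> where "\<tau> s = ?c * (\<Sum>i. total_noise (i + s))" for s
  have \<tau>: "\<tau> \<longlonglongrightarrow> 0"
    unfolding \<tau>_def using tendsto_mult_right[OF tail_noise_tendsto_0, of ?c] by simp
  have LM [measurable]: "L t \<in> borel_measurable M" for t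
    by (rule measurable_past_imp[OF past_L])
  have L_int: "integrable M (L t)" for t by (rule past_integrable[OF past_L])
  have sq_int: "integrable M (\<lambda>\<omega>. (L t \<omega> - L s \<omega>)\<^sup>2)" for s t
  proof (rule past_integrable[of _ "max s t"])
    have [measurable]: "L s \<in> borel_measurable (past (max s t))" "L t \<in> borel_measurable (past (max s t))"
      by (auto intro: past_mono[OF _ past_L])
    show "(\<lambda>\<omega>. (L t \<omega> - L s \<omega>)\<^sup>2) \<in> borel_measurable (past (max s t))" by measurable
  qed
  have "\<exists>N. \<forall>i\<ge>N. \<forall>j\<ge>N. (\<integral>\<omega>. norm (L i \<omega> - L j \<omega>) \<partial>M) < \<delta>" if "\<delta> > 0" for \<delta>
  proof -
    have "\<delta>\<^sup>2 / 4 > 0" using that by simp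
    then obtain N where N: "\<And>s. s \<ge> N \<Longrightarrow> \<tau> s < \<delta>\<^sup>2 / 4"
      using order_tendstoD(2)[OF \<tau>] unfolding eventually_sequentially by blast
    have one: "(\<integral>\<omega>. norm (L i \<omega> - L j \<omega>) \<partial>M) < \<delta>" if ij: "i \<ge> N" "j \<ge> N" "j \<le> i" for i j
    proof -
      \<comment> \<open>Passes from mean square to mean: with \<tau> below
        \<open>\<delta>\<^sup>2 / 4\<close>, each summand has mean at most
        \<open>\<delta> / 4\<close>.\<close>
      have pw: "norm (L i \<omega> - L j \<omega>) \<le> (L i \<omega> - L j \<omega>)\<^sup>2 / \<delta> + \<delta> / 4" for \<omega>
      proof -
        define y where "y = norm (L i \<omega> - L j \<omega>)"
        have y2: "(L i \<omega> - L j \<omega>)\<^sup>2 = y\<^sup>2" by (simp add: y_def)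
        have "0 \<le> (y - \<delta> / 2)\<^sup>2" by simp
        then have "y * \<delta> \<le> y\<^sup>2 + \<delta>\<^sup>2 / 4" by (simp add: power2_eq_square algebra_simps)
        then show ?thesis unfolding y2 y_def[symmetric] using \<open>\<delta> > 0\<close> by (simp add: field_simps power2_eq_square)
      qed
      have "(\<integral>\<omega>. norm (L i \<omega> - L j \<omega>) \<partial>M) \<le> (\<integral>\<omega>. (L i \<omega> - L j \<omega>)\<^sup>2 / \<delta> + \<delta> / 4 \<partial>M)"
        using sq_int L_int pw by (intro integral_mono) auto
      also have "\<dots> = (\<integral>\<omega>. (L i \<omega> - L j \<omega>)\<^sup>2 \<partial>M) / \<delta> + \<delta> / 4"
        using sq_int by (simp add: prob_space)
      also have "\<dots> \<le> (\<delta>\<^sup>2 / 4) / \<delta> + \<delta> / 4"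
      proof -
        have "(\<integral>\<omega>. (L i \<omega> - L j \<omega>)\<^sup>2 \<partial>M) \<le> \<delta>\<^sup>2 / 4"
          using expectation_L_increment[OF ij(3)] N[OF ij(2)] unfolding \<tau>_def by linarith
        then show ?thesis using \<open>\<delta> > 0\<close> by (intro add_right_mono divide_right_mono) auto
      qed
      also have "\<dots> < \<delta>" using \<open>\<delta> > 0\<close> by (simp add: power2_eq_square)
      finally show ?thesis .
    qed
    have "(\<integral>\<omega>. norm (L i \<omega> - L j \<omega>) \<partial>M) < \<delta>" if "i \<ge> N" "j \<ge> N" for i j
      using one[of i j] one[of j i] that by (cases "j \<le> i") (auto simp: abs_minus_commute)
    then show ?thesis by blast
  qed
  then obtain \<rho> where \<rho>: "strict_mono \<rho>" and Cauchy: "AE \<omega> in M. Cauchy (\<lambda>k. L (\<rho> k) \<omega>)"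
    using cauchy_L1_AE_cauchy_subseq[of M L] L_int by blast
  \<comment> \<open>Where the subsequence diverges, \<open>lim\<close> is an arbitrary value; the
    bounds on \<open>X\<close> are therefore claimed almost everywhere.\<close>
  define X where "X \<omega> = lim (\<lambda>k. L (\<rho> k) \<omega>)" for \<omega>
  have XM [measurable]: "X \<in> borel_measurable M" unfolding X_def by measurable
  have lim: "AE \<omega> in M. (\<lambda>k. L (\<rho> k) \<omega>) \<longlonglongrightarrow> X \<omega>"
    using Cauchy unfolding X_def
    by eventually_elim (simp add: Cauchy_convergent_iff convergent_LIMSEQ_iff)
  have X_bounds: "AE \<omega> in M. 0 \<le> X \<omega> \<and> X \<omega> \<le> mass"
    using lim AE_space
  proof eventually_elim
    case (elim \<omega>)
    then show ?case
      using LIMSEQ_le_const[OF elim(1), of 0] LIMSEQ_le_const2[OF elim(1), of mass] L_bounds by blast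
  qed
  \<comment> \<open>Only the second argument runs along the subsequence; \<open>t\<close> is
    arbitrary, so the whole sequence converges to \<open>X\<close>.\<close>
  have dist_le: "(\<integral>\<omega>. (L t \<omega> - X \<omega>)\<^sup>2 \<partial>M) \<le> \<tau> t" for t
  proof (rule LIMSEQ_le_const2)
    show "(\<lambda>k. \<integral>\<omega>. (L t \<omega> - L (\<rho> k) \<omega>)\<^sup>2 \<partial>M) \<longlonglongrightarrow> (\<integral>\<omega>. (L t \<omega> - X \<omega>)\<^sup>2 \<partial>M)"
    proof (rule integral_dominated_convergence[where w = "\<lambda>_. mass\<^sup>2"])
      show "AE \<omega> in M. (\<lambda>k. (L t \<omega> - L (\<rho> k) \<omega>)\<^sup>2) \<longlonglongrightarrow> (L t \<omega> - X \<omega>)\<^sup>2"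
        using lim by eventually_elim (intro tendsto_intros)
      show "AE \<omega> in M. norm ((L t \<omega> - L (\<rho> k) \<omega>)\<^sup>2) \<le> mass\<^sup>2" for k
      proof (rule AE_I2)
        fix \<omega> assume \<omega>: "\<omega> \<in> space M"
        have "\<bar>L t \<omega> - L (\<rho> k) \<omega>\<bar> \<le> \<bar>mass\<bar>"
          using L_bounds[OF \<omega>, of t] L_bounds[OF \<omega>, of "\<rho> k"] by auto
        then show "norm ((L t \<omega> - L (\<rho> k) \<omega>)\<^sup>2) \<le> mass\<^sup>2" by (simp add: abs_le_square_iff)
      qed
    qed auto
    have "(\<integral>\<omega>. (L t \<omega> - L (\<rho> k) \<omega>)\<^sup>2 \<partial>M) \<le> \<tau> t" if "k \<ge> t" for k
    proof -
      have "t \<le> \<rho> k" using seq_suble[OF \<rho>, of k] that by linarith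
      then show ?thesis
        using expectation_L_increment[of t "\<rho> k"] unfolding \<tau>_def by (simp add: power2_commute)
    qed
    then show "\<exists>N. \<forall>k\<ge>N. (\<integral>\<omega>. (L t \<omega> - L (\<rho> k) \<omega>)\<^sup>2 \<partial>M) \<le> \<tau> t" by blast
  qed
  have "(\<lambda>t. \<integral>\<omega>. (L t \<omega> - X \<omega>)\<^sup>2 \<partial>M) \<longlonglongrightarrow> 0"
    by (rule tendsto_sandwich[OF _ _ tendsto_const \<tau>]) (auto simp: dist_le intro!: always_eventually)
  then show thesis using that XM X_bounds by blast
qed

section \<open>Dissipation controls the spread of the shares\<close>

lemma path_difference:
  assumes "(i, j) \<in> {(k, l). {k, l} \<in> E}\<^sup>*"
  shows "\<exists>C\<ge>0. \<forall>t. \<forall>\<omega>. \<bar>x t \<omega> i - x t \<omega> j\<bar> \<le> C * sqrt (dissipation t \<omega>)"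
  using assms
proof (induction rule: rtrancl_induct)
  case base
  then show ?case by (intro exI[of _ 0]) auto
next
  case (step j l)
  then obtain C where C: "C \<ge> 0" "\<And>t \<omega>. \<bar>x t \<omega> i - x t \<omega> j\<bar> \<le> C * sqrt (dissipation t \<omega>)" by blast
  have jl: "{j, l} \<in> E" using step by auto
  have near: "\<bar>x t \<omega> k - p t \<omega> {j, l}\<bar> \<le> sqrt (dissipation t \<omega>)" if k: "k \<in> {j, l}" for t \<omega> k
  proof -
    have "(x t \<omega> k - p t \<omega> {j, l})\<^sup>2 \<le> (\<Sum>k\<in>{j, l}. (x t \<omega> k - p t \<omega> {j, l})\<^sup>2)"
      by (rule member_le_sum[OF k]) auto
    also have "\<dots> \<le> dissipation t \<omega>"
      unfolding dissipation_def
      by (rule member_le_sum[OF jl, of "\<lambda>\<epsilon>. \<Sum>k\<in>\<epsilon>. (x t \<omega> k - p t \<omega> \<epsilon>)\<^sup>2"])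
        (auto intro: sum_nonneg finite_E)
    finally show ?thesis using real_sqrt_le_mono by fastforce
  qed
  \<comment> \<open>Both endpoints are within the root of the dissipation of the edge share, so each
    edge of the path adds 2 to the constant.\<close>
  have "\<bar>x t \<omega> i - x t \<omega> l\<bar> \<le> (C + 2) * sqrt (dissipation t \<omega>)" for t \<omega>
    using C(2)[of t \<omega>] near[of j t \<omega>] near[of l t \<omega>] by (simp add: distrib_right)
  then show ?case using C(1) by (intro exI[of _ "C + 2"]) auto
qed

lemma uniform_difference:
  "\<exists>C\<ge>0. \<forall>i\<in>V. \<forall>j\<in>V. \<forall>t \<omega>. \<bar>x t \<omega> i - x t \<omega> j\<bar> \<le> C * sqrt (dissipation t \<omega>)"
proof -
  have diss: "dissipation t \<omega> \<ge> 0" for t \<omega> unfolding dissipation_def by (intro sum_nonneg) auto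
  have "\<forall>i\<in>V. \<forall>j\<in>V. \<exists>C\<ge>0. \<forall>t \<omega>. \<bar>x t \<omega> i - x t \<omega> j\<bar> \<le> C * sqrt (dissipation t \<omega>)"
    using path_difference connected by (simp add: connected_graph_def)
  then obtain C where C: "\<And>i j. i \<in> V \<Longrightarrow> j \<in> V \<Longrightarrow> C i j \<ge> 0"
    "\<And>i j t \<omega>. i \<in> V \<Longrightarrow> j \<in> V \<Longrightarrow> \<bar>x t \<omega> i - x t \<omega> j\<bar> \<le> C i j * sqrt (dissipation t \<omega>)"
    by metis
  \<comment> \<open>A common upper bound of finitely many nonnegative constants.\<close>
  define B where "B = (\<Sum>i\<in>V. \<Sum>j\<in>V. C i j)"
  have "\<bar>x t \<omega> i - x t \<omega> j\<bar> \<le> B * sqrt (dissipation t \<omega>)" if "i \<in> V" "j \<in> V" for i j t \<omega>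
  proof -
    have "C i j \<le> (\<Sum>j\<in>V. C i j)" using that C(1) finite_V by (intro member_le_sum) auto
    also have "\<dots> \<le> B" unfolding B_def
      using that C(1) finite_V by (intro member_le_sum[of i V "\<lambda>i. \<Sum>j\<in>V. C i j"]) (auto intro!: sum_nonneg)
    finally have "C i j * sqrt (dissipation t \<omega>) \<le> B * sqrt (dissipation t \<omega>)"
      using diss by (intro mult_right_mono) auto
    then show ?thesis using C(2)[OF that, of t \<omega>] by linarith
  qed
  moreover have "B \<ge> 0" unfolding B_def using C(1) by (intro sum_nonneg) auto
  ultimately show ?thesis by blast
qed

text \<open>\<open>L t \<omega> / mass\<close> is the mean of the shares under the weights
  \<open>(D k)\<^sup>2\<close>, so this is their variance times \<open>mass\<close>.\<close>

definition deviation :: "nat \<Rightarrow> 'a \<Rightarrow> real" where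
  "deviation t \<omega> = (\<Sum>k\<in>V. (D k)\<^sup>2 * (x t \<omega> k - L t \<omega> / mass)\<^sup>2)"

lemma deviation_eq: "deviation t \<omega> = S t \<omega> - (L t \<omega>)\<^sup>2 / mass"
proof -
  define m where "m = L t \<omega> / mass"
  have "deviation t \<omega> = (\<Sum>k\<in>V. (D k)\<^sup>2 * (x t \<omega> k)\<^sup>2 - 2 * m * ((D k)\<^sup>2 * x t \<omega> k) + m\<^sup>2 * (D k)\<^sup>2)"
    unfolding deviation_def m_def[symmetric]
    by (intro sum.cong) (auto simp: power2_eq_square algebra_simps)
  also have "\<dots> = S t \<omega> - 2 * m * L t \<omega> + m\<^sup>2 * mass"
    unfolding S_def L_def mass_def sum_distrib_left by (simp add: sum.distrib sum_subtractf)
  also have "\<dots> = S t \<omega> - (L t \<omega>)\<^sup>2 / mass"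
    unfolding m_def using mass_pos by (simp add: power2_eq_square field_simps)
  finally show ?thesis .
qed

text \<open>The distance of a share from the weighted mean is at most the weighted average of its
  distances to all shares, each controlled by \<open>uniform_difference\<close>.\<close>

lemma deviation_le_dissipation: "\<exists>C\<ge>0. \<forall>t \<omega>. deviation t \<omega> \<le> C * dissipation t \<omega>"
proof -
  obtain C where C: "C \<ge> 0"
    "\<And>i j t \<omega>. i \<in> V \<Longrightarrow> j \<in> V \<Longrightarrow> \<bar>x t \<omega> i - x t \<omega> j\<bar> \<le> C * sqrt (dissipation t \<omega>)"
    using uniform_difference by blast
  have diss: "dissipation t \<omega> \<ge> 0" for t \<omega> unfolding dissipation_def by (intro sum_nonneg) auto
  have "deviation t \<omega> \<le> mass * C\<^sup>2 * dissipation t \<omega>" for t \<omega>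
  proof -
    have "(x t \<omega> i - L t \<omega> / mass)\<^sup>2 \<le> C\<^sup>2 * dissipation t \<omega>" if i: "i \<in> V" for i
    proof -
      have "mass * (x t \<omega> i - L t \<omega> / mass) = mass * x t \<omega> i - L t \<omega>"
        using mass_pos by (simp add: field_simps)
      also have "\<dots> = (\<Sum>j\<in>V. (D j)\<^sup>2 * (x t \<omega> i - x t \<omega> j))"
        unfolding mass_def L_def sum_distrib_right by (simp add: sum_subtractf right_diff_distrib)
      finally have "mass * \<bar>x t \<omega> i - L t \<omega> / mass\<bar> = \<bar>\<Sum>j\<in>V. (D j)\<^sup>2 * (x t \<omega> i - x t \<omega> j)\<bar>"
        using mass_pos by (metis abs_mult abs_of_pos)
      also have "\<dots> \<le> (\<Sum>j\<in>V. \<bar>(D j)\<^sup>2 * (x t \<omega> i - x t \<omega> j)\<bar>)" by (rule sum_abs)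
      also have "\<dots> \<le> (\<Sum>j\<in>V. (D j)\<^sup>2 * (C * sqrt (dissipation t \<omega>)))"
        using C(2)[OF i] by (intro sum_mono) (auto simp: abs_mult intro!: mult_left_mono)
      also have "\<dots> = mass * (C * sqrt (dissipation t \<omega>))"
        unfolding mass_def by (simp add: sum_distrib_right)
      finally have "\<bar>x t \<omega> i - L t \<omega> / mass\<bar> \<le> C * sqrt (dissipation t \<omega>)"
        using mass_pos by simp
      then have "\<bar>x t \<omega> i - L t \<omega> / mass\<bar>\<^sup>2 \<le> (C * sqrt (dissipation t \<omega>))\<^sup>2"
        by (intro power_mono) auto
      then show ?thesis using diss by (simp add: power_mult_distrib)
    qed
    then have "deviation t \<omega> \<le> (\<Sum>k\<in>V. (D k)\<^sup>2 * (C\<^sup>2 * dissipation t \<omega>))"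
      unfolding deviation_def by (intro sum_mono mult_left_mono) auto
    also have "\<dots> = mass * C\<^sup>2 * dissipation t \<omega>"
      unfolding mass_def by (simp add: sum_distrib_right mult.assoc)
    finally show ?thesis .
  qed
  then show ?thesis using mass_pos by (intro exI[of _ "mass * C\<^sup>2"]) auto
qed

section \<open>Vanishing variance and consensus\<close>

lemma expectation_deviation_tendsto_0: "(\<lambda>t. \<integral>\<omega>. deviation t \<omega> \<partial>M) \<longlonglongrightarrow> 0"
proof -
  have diss: "dissipation t \<omega> \<ge> 0" for t \<omega> unfolding dissipation_def by (intro sum_nonneg) auto
  have dev: "deviation t \<omega> \<ge> 0" for t \<omega> unfolding deviation_def by (intro sum_nonneg) auto
  let ?c = "\<lambda>t. 2 / ((card E)\<^sup>2 * real (Suc t)) * (\<integral>\<omega>. dissipation t \<omega> \<partial>M)"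
  have S: "convergent (\<lambda>t. \<integral>\<omega>. S t \<omega> \<partial>M)" and c: "summable ?c"
  proof -
    have "\<integral>\<omega>. S t \<omega> \<partial>M \<ge> 0" for t
      unfolding S_def by (intro integral_nonneg_AE AE_I2 sum_nonneg) auto
    moreover have "?c t \<ge> 0" for t
      using diss by (intro mult_nonneg_nonneg integral_nonneg_AE AE_I2) auto
    moreover have "summable (\<lambda>t. 4 * total_noise t)" by (intro summable_mult summable_total_noise)
    ultimately show "convergent (\<lambda>t. \<integral>\<omega>. S t \<omega> \<partial>M)" "summable ?c"
      using almost_decreasing_convergent[of "\<lambda>t. \<integral>\<omega>. S t \<omega> \<partial>M" ?c "\<lambda>t. 4 * total_noise t"]
        expectation_S_step total_noise_nonneg by auto
  qed
  \<comment> \<open>A one-sided bound suffices: the mean square is nonnegative and can rise only by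
    summable amounts.\<close>
  have L: "convergent (\<lambda>t. \<integral>\<omega>. (L t \<omega>)\<^sup>2 \<partial>M)"
  proof (rule almost_decreasing_convergent(1)[where c = "\<lambda>_. 0"])
    show "(\<integral>\<omega>. (L (Suc t) \<omega>)\<^sup>2 \<partial>M)
      \<le> (\<integral>\<omega>. (L t \<omega>)\<^sup>2 \<partial>M) - 0 + (2 * real (card V) + 2) * total_noise t" for t
      using expectation_L_step[of "\<lambda>_. 0" t] mass_pos by simp
    show "summable (\<lambda>t. (2 * real (card V) + 2) * total_noise t)"
      by (intro summable_mult summable_total_noise)
  qed (auto simp: total_noise_nonneg)
  have int: "integrable M (S t)" "integrable M (\<lambda>\<omega>. (L t \<omega>)\<^sup>2)" "integrable M (dissipation t)" for t
    by (rule past_integrable[of _ t], measurable)+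
  have eq: "(\<integral>\<omega>. deviation t \<omega> \<partial>M) = (\<integral>\<omega>. S t \<omega> \<partial>M) - (\<integral>\<omega>. (L t \<omega>)\<^sup>2 \<partial>M) / mass" for t
    unfolding deviation_eq using int by simp
  have dev_int: "integrable M (deviation t)" for t
    unfolding deviation_eq[abs_def] using int by simp
  obtain C where C: "C \<ge> 0" "\<And>t \<omega>. deviation t \<omega> \<le> C * dissipation t \<omega>"
    using deviation_le_dissipation by blast
  show ?thesis
  proof (rule harmonic_weighted_limit_zero)
    show "convergent (\<lambda>t. \<integral>\<omega>. deviation t \<omega> \<partial>M)"
      unfolding eq divide_inverse using S L by (intro convergent_diff convergent_mult convergent_const)
    show nn: "(\<integral>\<omega>. deviation t \<omega> \<partial>M) \<ge> 0" for t
      using dev by (intro integral_nonneg_AE AE_I2) auto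
    \<comment> \<open>Undoes the factor \<open>2 / (card E)\<^sup>2\<close> in the loss term
      \<open>?c\<close>.\<close>
    let ?k = "C * (card E)\<^sup>2 / 2"
    show "summable (\<lambda>t. (\<integral>\<omega>. deviation t \<omega> \<partial>M) / Suc t)"
    proof (rule summable_comparison_test[OF _ summable_mult[OF c, of ?k]], intro exI allI impI)
      fix t
      have "(\<integral>\<omega>. deviation t \<omega> \<partial>M) \<le> (\<integral>\<omega>. C * dissipation t \<omega> \<partial>M)"
        using C int dev_int by (intro integral_mono) auto
      then have "(\<integral>\<omega>. deviation t \<omega> \<partial>M) / Suc t \<le> C * (\<integral>\<omega>. dissipation t \<omega> \<partial>M) / Suc t"
        by (intro divide_right_mono) auto
      moreover have "C * I / T = C * q / 2 * (2 / (q * T) * I)" if "q > 0" for q I T :: real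
        using that by simp
      then have "C * (\<integral>\<omega>. dissipation t \<omega> \<partial>M) / Suc t = ?k * ?c t" using card_E_pos by simp
      ultimately show "norm ((\<integral>\<omega>. deviation t \<omega> \<partial>M) / Suc t) \<le> ?k * ?c t" using nn[of t] by simp
    qed
  qed
qed

lemma L2_convergence:
  "\<exists>a. a \<in> borel_measurable M \<and> (\<forall>\<omega>\<in>space M. 0 \<le> a \<omega> \<and> a \<omega> \<le> (1 :: real)) \<and>
    (\<lambda>t. \<integral>\<omega>. (L2_set (\<lambda>i. x t \<omega> i - a \<omega>) V)\<^sup>2 \<partial>M) \<longlonglongrightarrow> 0"
proof -
  obtain X where XM [measurable]: "X \<in> borel_measurable M"
    and X: "AE \<omega> in M. 0 \<le> X \<omega> \<and> X \<omega> \<le> mass"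
    and lim: "(\<lambda>t. \<integral>\<omega>. (L t \<omega> - X \<omega>)\<^sup>2 \<partial>M) \<longlonglongrightarrow> 0"
    by (rule L_convergent)
  \<comment> \<open>Clipping makes the bounds hold at every outcome; almost everywhere it changes
    nothing.\<close>
  define a where "a \<omega> = max 0 (min 1 (X \<omega> / mass))" for \<omega>
  have aM [measurable]: "a \<in> borel_measurable M" unfolding a_def by measurable
  have a01: "0 \<le> a \<omega>" "a \<omega> \<le> 1" for \<omega> by (auto simp: a_def)
  have LM [measurable]: "L t \<in> borel_measurable M" for t
    by (rule measurable_past_imp[OF past_L])
  have xM [measurable]: "(\<lambda>\<omega>. x t \<omega> i) \<in> borel_measurable M" if "i \<in> V" for t i
    by (rule measurable_past_imp[OF past_x[OF that]])
  let ?m = "real (card E)" and ?n = "real (card V)"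
  define N where "N t \<omega> = (\<Sum>i\<in>V. (x t \<omega> i - a \<omega>)\<^sup>2)" for t \<omega>
  have N: "(L2_set (\<lambda>i. x t \<omega> i - a \<omega>) V)\<^sup>2 = N t \<omega>" for t \<omega>
    unfolding L2_set_def N_def by (simp add: sum_nonneg)
  \<comment> \<open>Combines the two quantities already known to vanish in mean: the variance about
    the weighted mean, and the squared distance of that mean from its limit, once per
    vertex.\<close>
  define Y where "Y t \<omega> = 2 * ?m\<^sup>2 * deviation t \<omega> + 2 * ?n / mass\<^sup>2 * (L t \<omega> - X \<omega>)\<^sup>2" for t \<omega>
  have le: "AE \<omega> in M. N t \<omega> \<le> Y t \<omega>" for t
    using X
  proof eventually_elim
    case (elim \<omega>)
    define l where "l = L t \<omega> / mass"
    have a: "a \<omega> = X \<omega> / mass" using elim mass_pos by (simp add: a_def min_def max_def)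
    have vertex: "(x t \<omega> i - a \<omega>)\<^sup>2 \<le> 2 * ?m\<^sup>2 * ((D i)\<^sup>2 * (x t \<omega> i - l)\<^sup>2) + 2 * (l - a \<omega>)\<^sup>2"
      if i: "i \<in> V" for i
    proof -
      \<comment> \<open>The lower bound on \<open>D\<close> compares the unweighted square with the
        weighted one, at the price of the factor \<open>?m\<^sup>2\<close>.\<close>
      have "1 \<le> ?m * D i" using D_ge[OF i] card_E_pos by (simp add: field_simps)
      then have "1 \<le> (?m * D i)\<^sup>2" by (simp add: one_le_power)
      then have "(x t \<omega> i - l)\<^sup>2 \<le> (?m * D i)\<^sup>2 * (x t \<omega> i - l)\<^sup>2"
        using mult_right_mono[of 1 "(?m * D i)\<^sup>2" "(x t \<omega> i - l)\<^sup>2"] by simp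
      moreover have "(x t \<omega> i - a \<omega>)\<^sup>2 \<le> 2 * (x t \<omega> i - l)\<^sup>2 + 2 * (l - a \<omega>)\<^sup>2"
        using zero_le_power2[of "(x t \<omega> i - l) - (l - a \<omega>)"] by (simp add: power2_eq_square algebra_simps)
      ultimately show ?thesis by (simp add: power_mult_distrib mult.assoc)
    qed
    have "N t \<omega> \<le> (\<Sum>i\<in>V. 2 * ?m\<^sup>2 * ((D i)\<^sup>2 * (x t \<omega> i - l)\<^sup>2) + 2 * (l - a \<omega>)\<^sup>2)"
      unfolding N_def by (rule sum_mono[OF vertex])
    also have "\<dots> = 2 * ?m\<^sup>2 * deviation t \<omega> + 2 * ?n * (l - a \<omega>)\<^sup>2"
      unfolding deviation_def l_def[symmetric] sum_distrib_left by (simp add: sum.distrib)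
    also have "(l - a \<omega>)\<^sup>2 = (L t \<omega> - X \<omega>)\<^sup>2 / mass\<^sup>2"
      unfolding l_def a by (simp add: diff_divide_distrib[symmetric] power_divide)
    finally show ?case unfolding Y_def by simp
  qed
  have dev_int: "integrable M (deviation t)" for t
    unfolding deviation_eq[abs_def] by (rule past_integrable[of _ t]) measurable
  have sq_int: "integrable M (\<lambda>\<omega>. (L t \<omega> - X \<omega>)\<^sup>2)" for t
  proof (rule integrable_const_bound[of _ "mass\<^sup>2"])
    show "AE \<omega> in M. norm ((L t \<omega> - X \<omega>)\<^sup>2) \<le> mass\<^sup>2"
      using X AE_space
    proof eventually_elim
      case (elim \<omega>)
      then have "\<bar>L t \<omega> - X \<omega>\<bar> \<le> \<bar>mass\<bar>" using L_bounds[of \<omega> t] by auto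
      then show ?case by (simp add: abs_le_square_iff)
    qed
  qed measurable
  have N_nonneg: "N t \<omega> \<ge> 0" for t \<omega> unfolding N_def by (intro sum_nonneg) auto
  have Y_int: "integrable M (Y t)" for t
    unfolding Y_def[abs_def] using dev_int sq_int by auto
  have N_int: "integrable M (N t)" for t
  proof (rule Bochner_Integration.integrable_bound[OF Y_int])
    show "N t \<in> borel_measurable M" unfolding N_def[abs_def] by measurable
    show "AE \<omega> in M. norm (N t \<omega>) \<le> norm (Y t \<omega>)"
      using le[of t] by eventually_elim (use N_nonneg in auto)
  qed
  have "(\<lambda>t. \<integral>\<omega>. N t \<omega> \<partial>M) \<longlonglongrightarrow> 0"
  proof (rule tendsto_sandwich[OF _ _ tendsto_const])
    show "\<forall>\<^sub>F t in sequentially. 0 \<le> (\<integral>\<omega>. N t \<omega> \<partial>M)"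
      using N_nonneg by (intro always_eventually allI integral_nonneg_AE AE_I2) auto
    show "\<forall>\<^sub>F t in sequentially. (\<integral>\<omega>. N t \<omega> \<partial>M) \<le> (\<integral>\<omega>. Y t \<omega> \<partial>M)"
      by (intro always_eventually allI integral_mono_AE N_int Y_int le)
    have "(\<integral>\<omega>. Y t \<omega> \<partial>M) = 2 * ?m\<^sup>2 * (\<integral>\<omega>. deviation t \<omega> \<partial>M)
      + 2 * ?n / mass\<^sup>2 * (\<integral>\<omega>. (L t \<omega> - X \<omega>)\<^sup>2 \<partial>M)" for t
      unfolding Y_def using dev_int sq_int by simp
    moreover have "(\<lambda>t. 2 * ?m\<^sup>2 * (\<integral>\<omega>. deviation t \<omega> \<partial>M)
      + 2 * ?n / mass\<^sup>2 * (\<integral>\<omega>. (L t \<omega> - X \<omega>)\<^sup>2 \<partial>M)) \<longlonglongrightarrow> 2 * ?m\<^sup>2 * 0 + 2 * ?n / mass\<^sup>2 * 0"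
      by (intro tendsto_intros lim expectation_deviation_tendsto_0)
    ultimately show "(\<lambda>t. \<integral>\<omega>. Y t \<omega> \<partial>M) \<longlonglongrightarrow> 0" by simp
  qed
  then show ?thesis using aM a01 N by (intro exI[of _ a]) simp
qed

end

theorem theorem1p1:
  fixes M :: "'w measure" and V :: "'v set" and E :: "'v set set"
    and u0 v0 :: "'v \<Rightarrow> real"
    and e :: "nat \<Rightarrow> 'w \<Rightarrow> 'v set" and agU :: "nat \<Rightarrow> 'w \<Rightarrow> bool"
    and u v :: "nat \<Rightarrow> 'w \<Rightarrow> 'v \<Rightarrow> real"
  assumes "simple_graph V E" and "connected_graph V E" and "E \<noteq> {}"
    and "\<And>i. i \<in> V \<Longrightarrow> u0 i \<ge> 0" and "\<And>i. i \<in> V \<Longrightarrow> v0 i \<ge> 0"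
    and "\<And>i. i \<in> V \<Longrightarrow> u0 i + v0 i > 0"
    and "opinion_process M V E u0 v0 e agU u v"
  shows "\<exists>a. a \<in> borel_measurable M \<and> (\<forall>\<omega>\<in>space M. 0 \<le> a \<omega> \<and> a \<omega> \<le> (1 :: real)) \<and>
    (\<lambda>t. \<integral>\<omega>. (L2_set (\<lambda>i. vertex_share (u t \<omega>) (v t \<omega>) i - a \<omega>) V)\<^sup>2 \<partial>M) \<longlonglongrightarrow> 0"
proof -
  interpret opinion_graph M V E u0 v0 e agU u v
    using assms by (simp add: opinion_graph_def opinion_graph_axioms_def)
  show ?thesis by (rule L2_convergence)
qed

end
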